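(* Consider the interacting urn system described in the context, with $N\ge 1$ urns and $K\ge 1$ colors. Assume: (A1) there exist $\delta>0$ and a constant $0<C_\delta<\infty$ such that $\mathbf{E}[(D^j_{ki,n})^{2+\delta}]<C_\delta$ for all $j\in\{1,\dots,N\}$ and $k,i\in\{1,\dots,K\}$; (A2) $\sum_{k=1}^K H^j_{ki}=1$ for all $j\in\{1,\dots,N\}$ and $i\in\{1,\dots,K\}$; (A3) $H^j$ is irreducible for all $j\in\{1,\dots,N\}$. Then for any leading system $S^l$, $l\in\mathcal{L}_L$, $$\mathbf{Z}^l_n\ \xrightarrow{a.s.}\ \mathbf{Z}^l_\infty:=\mathbf{V}_1\qquad (n\to\infty),$$ where $\mathbf{V}_1\in\mathbb{R}^{s^lK}$ is the right eigenvector associated to the simple eigenvalue $\lambda=1$ of the matrix $\mathbf{Q}^l=\mathbf{H}^l\mathbf{W}^l$, normalized so that the $K$ components of $\mathbf{V}_1$ relative to each urn $j\in S^l$ sum to $1$.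
   Context: **Model.** There are $N\ge1$ urns and $K\ge1$ colors. $Y^j_{k,n}>0$ is the (real) amount of balls of color $k$ in urn $j$ at time $n\ge0$; the initial amounts $Y^j_{k,0}>0$ are given constants. $T^j_n:=\sum_{k=1}^K Y^j_{k,n}$ and $Z^j_{k,n}:=Y^j_{k,n}/T^j_n$. Let $\mathcal{F}_{n}$ be the $\sigma$-algebra generated by all $X^j_{k,t},Y^j_{k,t}$ up to time $n$. $W=[w_{jh}]$ is a fixed $N\times N$ matrix (interacting matrix) with $0\le w_{jh}\le1$ and $\sum_{h=1}^N w_{jh}=1$ for every $j$. At each time $n\ge1$, in each urn $j$ one color is sampled: $X^j_{i,n}=1$ if color $i$ is sampled and $X^j_{i,n}=0$ otherwise, with $$\mathbf{E}[X^j_{i,n}\mid\mathcal{F}_{n-1}]=\tilde Z^j_{i,n-1}:=\sum_{h=1}^N w_{jh}Z^h_{i,n-1},$$ and, conditionally on $\mathcal{F}_{n-1}$, the colors are sampled independently in the $N$ urns. Then $$Y^j_{k,n}=Y^j_{k,n-1}+\sum_{i=1}^K D^j_{ki,n}X^j_{i,n},$$ where for each $j$ the replacement matrices $D^j_n=[D^j_{ki,n}]_{ki}$, $n\ge1$, are i.i.d. non-negative random $K\times K$ matrices, with $D^j_n$ independent of $\mathcal{F}_{n-1}$, of the sampled colors at time $n$, and of the replacement matrices of the other urns. $H^j:=\mathbf{E}[D^j_n]$ is the generating matrix of urn $j$. **Decomposition of $W$.** View $W$ as the transition matrix of a Markov chain on $\{1,\dots,N\}$ and order the urns so that each communicating class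 is a block of consecutive urns, the recurrent classes (labels $\mathcal{L}_L=\{L_1,\dots,L_{n_L}\}$) coming first, followed by the transient classes (labels $\mathcal{L}_F=\{F_1,\dots,F_{n_F}\}$), so that $W$ is block lower triangular with irreducible diagonal blocks $W^l$, $l\in\mathcal{L}_L\cup\mathcal{L}_F$. The class labelled $l$ is the set of urns $S^l=\{r^{l^-}+1,\dots,r^l\}$, where $l^-$ is the label preceding $l$ (with $r^{L_1^-}=0$), and it has $s^l:=r^l-r^{l^-}$ urns. The systems $S^l$ with $l\in\mathcal{L}_L$ are the leading systems: for them $w_{jh}=0$ for $j\in S^l$, $h\notin S^l$, and $W^l$ is an irreducible stochastic matrix. **Joint notation.** $Z^j_n=(Z^j_{1,n},\dots,Z^j_{K,n})'$, and $\mathbf{Z}^l_n\in\mathbb{R}^{s^lK}$ is obtained by stacking the vectors $Z^j_n$, $j\in S^l$. $\mathbf{H}^l$ is the block diagonal $s^lK\times s^lK$ matrix with blocks $H^j$, $j\in S^l$. $\mathbf{W}^l$ is the $s^lK\times s^lK$ matrix obtained from $W^l$ by replacing each entry $w_{jh}$ with $w_{jh}I_K$. $\mathbf{Q}^l:=\mathbf{H}^l\mathbf{W}^l$.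
   Formalization: That 1 is a simple eigenvalue of Q^l is assumed for the leading system considered; it does not follow from (A1)–(A3): for N=K=2 with W and all D^j_n equal to the swap matrix, 1 has multiplicity two and the normalized V_1 is not unique. *)

theory Defs
  imports
    "HOL-Probability.Probability"
    "Jordan_Normal_Form.Char_Poly"
begin

unbundle no vec_syntax

(* Conventions: urns are indexed by {..<N}, colors by {..<K}, both starting from 0.
   X j i n, Y j k n and D j n k i stand for X^j_{i,n}, Y^j_{k,n} and D^j_{ki,n}. *)

section \<open>Non-negative matrices and the chain with transition matrix \<open>W\<close>\<close>

definition leads_to :: "real mat \<Rightarrow> nat \<Rightarrow> nat \<Rightarrow> bool" where
  "leads_to A i j \<longleftrightarrow> (\<exists>n. (A ^\<^sub>m n) $$ (i, j) > 0)"

(* For entrywise non-negative square matrices.  The power n = 0 is allowed in leads_to, so every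
   1 x 1 matrix is irreducible and a state always communicates with itself. *)
definition irreducible_mat :: "real mat \<Rightarrow> bool" where
  "irreducible_mat A \<longleftrightarrow> (\<forall>i<dim_row A. \<forall>j<dim_row A. leads_to A i j)"

definition communicate :: "real mat \<Rightarrow> nat \<Rightarrow> nat \<Rightarrow> bool" where
  "communicate A i j \<longleftrightarrow> leads_to A i j \<and> leads_to A j i"

(* Probability that the chain with transition matrix A started at i hits j, at a time >= 1,
   for the first time at time n. *)
fun first_passage :: "real mat \<Rightarrow> nat \<Rightarrow> nat \<Rightarrow> nat \<Rightarrow> real" where
  "first_passage A 0 i j = 0"
| "first_passage A (Suc 0) i j = A $$ (i, j)"
| "first_passage A (Suc (Suc n)) i j =
     (\<Sum>h\<in>{..<dim_row A} - {j}. A $$ (i, h) * first_passage A (Suc n) h j)"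

definition recurrent_state :: "real mat \<Rightarrow> nat \<Rightarrow> bool" where
  "recurrent_state A j \<longleftrightarrow> (\<lambda>n. first_passage A n j j) sums 1"

(* The classes are labelled 1, ..., nL (recurrent: L_1, L_2, ...) and nL + 1, ..., nL + nF
   (transient: F_1, F_2, ...), so that the label preceding l is l - 1, and r 0 = 0.
   With urns numbered from 0, the set {r^{l-}+1, ..., r^l} becomes {r (l - 1)..<r l}. *)
definition urn_class :: "(nat \<Rightarrow> nat) \<Rightarrow> nat \<Rightarrow> nat set" where
  "urn_class r l = {r (l - 1)..<r l}"

definition class_size :: "(nat \<Rightarrow> nat) \<Rightarrow> nat \<Rightarrow> nat" where
  "class_size r l = r l - r (l - 1)"

definition class_decomposition ::
    "nat \<Rightarrow> real mat \<Rightarrow> nat \<Rightarrow> nat \<Rightarrow> (nat \<Rightarrow> nat) \<Rightarrow> bool" where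
  "class_decomposition N W nL nF r \<longleftrightarrow>
     r 0 = 0 \<and> r (nL + nF) = N \<and> (\<forall>l<nL + nF. r l < r (Suc l)) \<and>
     (\<forall>l\<in>{1..nL + nF}. \<forall>j\<in>urn_class r l. urn_class r l = {h. h < N \<and> communicate W j h}) \<and>
     (\<forall>l\<in>{1..nL}. \<forall>j\<in>urn_class r l. recurrent_state W j) \<and>
     (\<forall>l\<in>{nL + 1..nL + nF}. \<forall>j\<in>urn_class r l. \<not> recurrent_state W j) \<and>
     (\<forall>l\<in>{1..nL + nF}. \<forall>m\<in>{1..nL + nF}. l < m \<longrightarrow>
        (\<forall>j\<in>urn_class r l. \<forall>h\<in>urn_class r m. W $$ (j, h) = 0))"

section \<open>The interacting urn system\<close>

definition total :: "nat \<Rightarrow> (nat \<Rightarrow> nat \<Rightarrow> nat \<Rightarrow> 'a \<Rightarrow> real) \<Rightarrow> nat \<Rightarrow> nat \<Rightarrow> 'a \<Rightarrow> real" where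
  "total K Y j n \<omega> = (\<Sum>k<K. Y j k n \<omega>)"

definition proportion ::
    "nat \<Rightarrow> (nat \<Rightarrow> nat \<Rightarrow> nat \<Rightarrow> 'a \<Rightarrow> real) \<Rightarrow> nat \<Rightarrow> nat \<Rightarrow> nat \<Rightarrow> 'a \<Rightarrow> real" where
  "proportion K Y j k n \<omega> = Y j k n \<omega> / total K Y j n \<omega>"

definition sampling_prob ::
    "nat \<Rightarrow> nat \<Rightarrow> real mat \<Rightarrow> (nat \<Rightarrow> nat \<Rightarrow> nat \<Rightarrow> 'a \<Rightarrow> real) \<Rightarrow>
      nat \<Rightarrow> nat \<Rightarrow> nat \<Rightarrow> 'a \<Rightarrow> real" where
  "sampling_prob N K W Y j i n \<omega> = (\<Sum>h<N. W $$ (j, h) * proportion K Y h i n \<omega>)"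

definition generated_algebra :: "'a measure \<Rightarrow> ('a \<Rightarrow> real) set \<Rightarrow> 'a measure" where
  "generated_algebra M G = sigma (space M) {f -` B \<inter> space M |f B. f \<in> G \<and> B \<in> sets borel}"

definition history_vars ::
    "nat \<Rightarrow> nat \<Rightarrow> (nat \<Rightarrow> nat \<Rightarrow> nat \<Rightarrow> 'a \<Rightarrow> real) \<Rightarrow>
      (nat \<Rightarrow> nat \<Rightarrow> nat \<Rightarrow> 'a \<Rightarrow> real) \<Rightarrow> nat \<Rightarrow> ('a \<Rightarrow> real) set" where
  "history_vars N K X Y n =
     {X j k t |j k t. j < N \<and> k < K \<and> 1 \<le> t \<and> t \<le> n} \<union>
     {Y j k t |j k t. j < N \<and> k < K \<and> t \<le> n}"

definition history ::
    "'a measure \<Rightarrow> nat \<Rightarrow> nat \<Rightarrow> (nat \<Rightarrow> nat \<Rightarrow> nat \<Rightarrow> 'a \<Rightarrow> real) \<Rightarrow>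
      (nat \<Rightarrow> nat \<Rightarrow> nat \<Rightarrow> 'a \<Rightarrow> real) \<Rightarrow> nat \<Rightarrow> 'a measure" where
  "history M N K X Y n = generated_algebra M (history_vars N K X Y n)"

abbreviation matrix_space :: "nat \<Rightarrow> (nat \<times> nat \<Rightarrow> real) measure" where
  "matrix_space K \<equiv> PiM ({..<K} \<times> {..<K}) (\<lambda>_. borel)"

(* D^j_n as a single random element of the space of K x K matrices *)
definition replacement_matrix ::
    "nat \<Rightarrow> (nat \<Rightarrow> nat \<Rightarrow> nat \<Rightarrow> nat \<Rightarrow> 'a \<Rightarrow> real) \<Rightarrow>
      nat \<Rightarrow> nat \<Rightarrow> 'a \<Rightarrow> nat \<times> nat \<Rightarrow> real" where
  "replacement_matrix K D j n \<omega> = (\<lambda>(k, i)\<in>{..<K} \<times> {..<K}. D j n k i \<omega>)"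

locale interacting_urns = prob_space M
  for M :: "'a measure" +
  fixes N K :: nat
    and W :: "real mat"
    and y0 :: "nat \<Rightarrow> nat \<Rightarrow> real"
    and X Y :: "nat \<Rightarrow> nat \<Rightarrow> nat \<Rightarrow> 'a \<Rightarrow> real"
    and D :: "nat \<Rightarrow> nat \<Rightarrow> nat \<Rightarrow> nat \<Rightarrow> 'a \<Rightarrow> real"
  assumes N_pos: "N \<ge> 1" and K_pos: "K \<ge> 1"
    and W_carrier: "W \<in> carrier_mat N N"
    and W_bounds: "\<And>j h. j < N \<Longrightarrow> h < N \<Longrightarrow> 0 \<le> W $$ (j, h) \<and> W $$ (j, h) \<le> 1"
    and W_row_sum: "\<And>j. j < N \<Longrightarrow> (\<Sum>h<N. W $$ (j, h)) = 1"
    and y0_pos: "\<And>j k. j < N \<Longrightarrow> k < K \<Longrightarrow> y0 j k > 0"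
    and Y_init: "\<And>j k \<omega>. j < N \<Longrightarrow> k < K \<Longrightarrow> \<omega> \<in> space M \<Longrightarrow> Y j k 0 \<omega> = y0 j k"
    and Y_step: "\<And>j k n \<omega>. j < N \<Longrightarrow> k < K \<Longrightarrow> \<omega> \<in> space M \<Longrightarrow>
      Y j k (Suc n) \<omega> = Y j k n \<omega> + (\<Sum>i<K. D j (Suc n) k i \<omega> * X j i (Suc n) \<omega>)"
    and X_measurable: "\<And>j i n. j < N \<Longrightarrow> i < K \<Longrightarrow> n \<ge> 1 \<Longrightarrow> X j i n \<in> borel_measurable M"
    and X_indicator: "\<And>j i n \<omega>. j < N \<Longrightarrow> i < K \<Longrightarrow> n \<ge> 1 \<Longrightarrow> \<omega> \<in> space M \<Longrightarrow>
      X j i n \<omega> \<in> {0, 1}"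
    and X_one_color: "\<And>j n \<omega>. j < N \<Longrightarrow> n \<ge> 1 \<Longrightarrow> \<omega> \<in> space M \<Longrightarrow> (\<Sum>i<K. X j i n \<omega>) = 1"
    and X_cond_exp: "\<And>j i n. j < N \<Longrightarrow> i < K \<Longrightarrow>
      AE \<omega> in M. real_cond_exp M (history M N K X Y n) (X j i (Suc n)) \<omega>
                  = sampling_prob N K W Y j i n \<omega>"
    \<comment> \<open>Conditional independence of the sampled colors: the events
      \<open>X j (c j) (Suc n) = 1\<close>, \<open>j < N\<close>, have product conditional probabilities.\<close>
    and X_cond_indep: "\<And>c n. (\<forall>j<N. c j < K) \<Longrightarrow>
      AE \<omega> in M. real_cond_exp M (history M N K X Y n) (\<lambda>\<omega>. \<Prod>j<N. X j (c j) (Suc n) \<omega>) \<omega>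
                  = (\<Prod>j<N. real_cond_exp M (history M N K X Y n) (X j (c j) (Suc n)) \<omega>)"
    and D_nonneg: "\<And>j n k i \<omega>. j < N \<Longrightarrow> n \<ge> 1 \<Longrightarrow> k < K \<Longrightarrow> i < K \<Longrightarrow> \<omega> \<in> space M \<Longrightarrow>
      D j n k i \<omega> \<ge> 0"
    and D_indep: "\<And>j. j < N \<Longrightarrow>
      indep_vars (\<lambda>_. matrix_space K) (replacement_matrix K D j) {1..}"
    and D_ident: "\<And>j m n. j < N \<Longrightarrow> m \<ge> 1 \<Longrightarrow> n \<ge> 1 \<Longrightarrow>
      distr M (matrix_space K) (replacement_matrix K D j m)
        = distr M (matrix_space K) (replacement_matrix K D j n)"
    \<comment> \<open>\<open>D\<^sup>j\<close> at time \<open>n + 1\<close> is independent, jointly, of the history up to time \<open>n\<close>, the colors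
      sampled at time \<open>n + 1\<close> and all replacement matrices of the other urns.\<close>
    and D_indep_rest: "\<And>j n. j < N \<Longrightarrow>
      indep_set
        (sets (vimage_algebra (space M) (replacement_matrix K D j (Suc n)) (matrix_space K)))
        (sets (generated_algebra M
          (history_vars N K X Y n \<union>
           {X h i (Suc n) |h i. h < N \<and> i < K} \<union>
           {D h m k i |h m k i. h < N \<and> h \<noteq> j \<and> m \<ge> 1 \<and> k < K \<and> i < K})))"

(* By D_ident the choice of the time index 1 is immaterial. *)
definition generating_mat ::
    "'a measure \<Rightarrow> nat \<Rightarrow> (nat \<Rightarrow> nat \<Rightarrow> nat \<Rightarrow> nat \<Rightarrow> 'a \<Rightarrow> real) \<Rightarrow> nat \<Rightarrow> real mat" where
  "generating_mat M K D j = Matrix.mat K K (\<lambda>(k, i). integral\<^sup>L M (D j 1 k i))"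

section \<open>Joint notation for one class\<close>

(* A stacked vector has the component of color k in the j-th urn of the class at position
   j * K + k (j < s, k < K). *)
definition joint_proportions ::
    "nat \<Rightarrow> (nat \<Rightarrow> nat) \<Rightarrow> (nat \<Rightarrow> nat \<Rightarrow> nat \<Rightarrow> 'a \<Rightarrow> real) \<Rightarrow> nat \<Rightarrow> nat \<Rightarrow> 'a \<Rightarrow> real Matrix.vec"
  where
  "joint_proportions K r Y l n \<omega> =
     Matrix.vec (class_size r l * K)
       (\<lambda>a. proportion K Y (r (l - 1) + a div K) (a mod K) n \<omega>)"

definition joint_H ::
    "'a measure \<Rightarrow> nat \<Rightarrow> (nat \<Rightarrow> nat) \<Rightarrow> (nat \<Rightarrow> nat \<Rightarrow> nat \<Rightarrow> nat \<Rightarrow> 'a \<Rightarrow> real) \<Rightarrow> nat \<Rightarrow> real mat"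
  where
  "joint_H M K r D l = diag_block_mat (map (generating_mat M K D) [r (l - 1)..<r l])"

definition joint_W :: "nat \<Rightarrow> (nat \<Rightarrow> nat) \<Rightarrow> real mat \<Rightarrow> nat \<Rightarrow> real mat" where
  "joint_W K r W l =
     Matrix.mat (class_size r l * K) (class_size r l * K)
       (\<lambda>(a, b). W $$ (r (l - 1) + a div K, r (l - 1) + b div K) * 1\<^sub>m K $$ (a mod K, b mod K))"

definition joint_Q ::
    "'a measure \<Rightarrow> nat \<Rightarrow> (nat \<Rightarrow> nat) \<Rightarrow> real mat \<Rightarrow> (nat \<Rightarrow> nat \<Rightarrow> nat \<Rightarrow> nat \<Rightarrow> 'a \<Rightarrow> real) \<Rightarrow>
      nat \<Rightarrow> real mat" where
  "joint_Q M K r W D l = joint_H M K r D l * joint_W K r W l"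

(* Simple: algebraic multiplicity one.  For joint_Q the eigenvalue 1 need not be simple even if W^l
   and all H^j are irreducible: for two urns and two colors with W = H^1 = H^2 = (0 1; 1 0), joint_Q
   is a permutation matrix with two 2-cycles and 1 has multiplicity two. *)
definition simple_eigenvalue :: "real mat \<Rightarrow> real \<Rightarrow> bool" where
  "simple_eigenvalue A x \<longleftrightarrow> order x (char_poly A) = 1"

definition urnwise_normalized :: "nat \<Rightarrow> nat \<Rightarrow> real Matrix.vec \<Rightarrow> bool" where
  "urnwise_normalized K s v \<longleftrightarrow> (\<forall>j<s. (\<Sum>k<K. v $ (j * K + k)) = 1)"

end

theory Submission
  imports Defs "HOL-Library.Discrete_Functions" "HOL-Real_Asymp.Real_Asymp"
begin

text \<open>
  Let \<open>A n\<close> be the average of the proportions \<open>Z 0, ..., Z (n - 1)\<close>. The increments of \<open>Y\<close> minus their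
  conditional means are orthogonal with bounded second moments, so by a strong law of large numbers
  \<open>Y n / n - Q (A n)\<close> tends to 0 almost surely. Summing over the colors, the totals are asymptotic
  to \<open>n\<close>, and hence \<open>Z n = Q (A n) + e n\<close> with \<open>e n\<close> tending to 0. From here on the argument is
  deterministic and works along each path: \<open>A (n + 1) = A n + (Q (A n) - A n + e n) / (n + 1)\<close>.

  The operator \<open>Q\<close> does not increase the maximum over the urns of the \<open>\<ell>\<^sub>1\<close>-norms, and it preserves the
  sum over the colors in each urn. For such an operator, \<open>R = (I + Q) / 2\<close> satisfies
  \<open>(I - Q) R ^^ m \<rightarrow> 0\<close>, so by compactness \<open>Q\<close> has a fixed point \<open>V\<close> with urn sums 1. As the eigenvalue
  1 is simple, no nonzero vector with vanishing urn sums is fixed; so \<open>R ^^ m\<close> tends to 0 on these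
  vectors, and \<open>A n - V\<close>, which is one of them, is contracted in an equivalent norm.
\<close>

text \<open>The obstacle is periodicity. That 1 is a simple eigenvalue of \<open>Q\<close> does not
  exclude other eigenvalues on the unit circle: two urns that sample only from each other, with a
  single color, produce the eigenvalue -1, and the powers of \<open>Q\<close> do not converge.
  Averaging with the identity fixes 1 and sends every other point of the unit circle into the open
  disc; since a step of size \<open>s\<close> along \<open>Q - I\<close> is a step of size
  \<open>2 * s\<close> along \<open>R - I\<close>, the recursion can be read as one for
  \<open>R\<close>. The averages \<open>A n\<close> are followed rather than \<open>Z n\<close>
  because they move with the deterministic step \<open>1 / (n + 1)\<close>, whereas the steps of
  \<open>Z n\<close> have the random size given by the current totals; the law of large numbers then
  concerns unweighted sums of noise. Algebraic multiplicity one forces geometric multiplicity one,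
  so a fixed vector is a multiple of \<open>V\<close>, and vanishing urn sums make the multiple
  zero. A leading class can be treated in isolation because a recurrent class is closed.\<close>

section \<open>Simple eigenvalues\<close>

text \<open>If some 2 x 2 minor of the pair were nonzero, the eigenspace would have dimension at
  least two and contain, for every coordinate, a nonzero vector vanishing there. Deleting that
  coordinate leaves an eigenvector of the principal submatrix, so \<open>x\<close> is a root of all
  the summands of the derivative of \<open>char_poly A\<close>, hence a multiple root.\<close>

lemma simple_eigenvalue_eigenvectors_parallel:
  fixes A :: "real mat"
  assumes A: "A \<in> carrier_mat n n" and simple: "simple_eigenvalue A x"
    and v: "v \<in> carrier_vec n" "A *\<^sub>v v = x \<cdot>\<^sub>v v"
    and u: "u \<in> carrier_vec n" "A *\<^sub>v u = x \<cdot>\<^sub>v u"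
    and i: "i < n" and j: "j < n"
  shows "v $ i * u $ j = u $ i * v $ j"
proof (rule ccontr)
  assume indep: "v $ i * u $ j \<noteq> u $ i * v $ j"
  have root: "poly (char_poly (mat_delete A m m)) x = 0" if m: "m < n" for m
  proof -
    obtain n' where n': "n = Suc n'" using m by (cases n) auto
    have del_A: "mat_delete A m m \<in> carrier_mat n' n'"
      using mat_delete_carrier[OF A[unfolded n']] by simp
    \<comment> \<open>The combination of \<open>v\<close> and \<open>u\<close> whose coordinate
      \<open>m\<close> cancels.\<close>
    define z where "z = (u $ m) \<cdot>\<^sub>v v - (v $ m) \<cdot>\<^sub>v u"
    have z: "z \<in> carrier_vec n" using u v by (simp add: z_def)
    have zm: "z $ m = 0" using u v m by (simp add: z_def)
    have Az: "A *\<^sub>v z = x \<cdot>\<^sub>v z"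
      unfolding z_def
      by (subst mult_minus_distrib_mat_vec[OF A])
         (use u v in \<open>auto simp: mult_mat_vec[OF A] algebra_simps\<close>)
    have nz: "z \<noteq> 0\<^sub>v n \<or> (u $ m = 0 \<and> v $ m = 0)"
    proof (rule ccontr)
      assume *: "\<not> ?thesis"
      have zc: "u $ m * v $ a = v $ m * u $ a" if "a < n" for a
      proof -
        have "z $ a = 0" using * that by simp
        thus ?thesis using that u v by (simp add: z_def)
      qed
      show False using * zc[OF i] zc[OF j] indep
        by (smt (verit, ccfv_threshold) mult.assoc mult.commute mult_cancel_left)
    qed
    \<comment> \<open>By \<open>nz\<close>, \<open>z\<close> can only be zero if \<open>v\<close>
      and \<open>u\<close> both vanish at \<open>m\<close>; then whichever of them is nonzero serves
      instead.\<close>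
    define y where "y = (if z = 0\<^sub>v n then (if v = 0\<^sub>v n then u else v) else z)"
    have y: "y \<in> carrier_vec n" "A *\<^sub>v y = x \<cdot>\<^sub>v y" "y $ m = 0"
      using z u v zm Az nz by (auto simp: y_def)
    have y0: "y \<noteq> 0\<^sub>v n"
      using indep i j unfolding y_def by auto
    define y' where "y' = Matrix.vec n' (\<lambda>a. y $ (insert_index m a))"
    have ins: "insert_index m ` {..<n'} = {..<n} - {m}"
      using insert_index_image[OF m[unfolded n']] by (auto simp: n' lessThan_atLeast0)
    have "mat_delete A m m *\<^sub>v y' = x \<cdot>\<^sub>v y'"
    proof (rule eq_vecI)
      fix a assume "a < dim_vec (x \<cdot>\<^sub>v y')"
      hence a: "a < n'" by (simp add: y'_def)
      have ia: "insert_index m a < n" using a ins by auto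
      have "(mat_delete A m m *\<^sub>v y') $ a
          = (\<Sum>b<n'. A $$ (insert_index m a, insert_index m b) * y $ insert_index m b)"
        using a del_A A
        by (auto simp: scalar_prod_def y'_def mat_delete_index[OF A[unfolded n'], symmetric]
              lessThan_atLeast0 n' m[unfolded n'] m intro!: sum.cong)
      also have "\<dots> = (\<Sum>b\<in>insert_index m ` {..<n'}. A $$ (insert_index m a, b) * y $ b)"
        by (subst sum.reindex) (auto intro: insert_index_inj_on)
      also have "\<dots> = (\<Sum>b<n. A $$ (insert_index m a, b) * y $ b)"
        unfolding ins using y(3) by (intro sum.mono_neutral_left) auto
      also have "\<dots> = (A *\<^sub>v y) $ insert_index m a"
        using ia A y(1) by (auto simp: scalar_prod_def lessThan_atLeast0)
      also have "\<dots> = (x \<cdot>\<^sub>v y') $ a" using y ia a by (simp add: y'_def)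
      finally show "(mat_delete A m m *\<^sub>v y') $ a = (x \<cdot>\<^sub>v y') $ a" .
    qed (use del_A in \<open>auto simp: y'_def\<close>)
    moreover have "y' \<noteq> 0\<^sub>v n'"
    proof
      assume *: "y' = 0\<^sub>v n'"
      have "y $ a = 0" if a: "a < n" for a
      proof (cases "a = m")
        case False
        then obtain b where b: "b < n'" "a = insert_index m b" using a ins by blast
        have "y' $ b = 0" using * b(1) by simp
        thus ?thesis using b by (simp add: y'_def)
      qed (use y in simp)
      hence "y = 0\<^sub>v n" using y(1) by (intro eq_vecI) auto
      thus False using y0 by simp
    qed
    ultimately have "eigenvalue (mat_delete A m m) x"
      using del_A by (auto simp: eigenvalue_def eigenvector_def y'_def intro!: exI[of _ y'])
    thus ?thesis using eigenvalue_root_char_poly[OF del_A] by simp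
  qed
  \<comment> \<open>The derivative of the characteristic polynomial is the sum of those of the
    principal submatrices of size \<open>n - 1\<close>.\<close>
  have "poly (pderiv (char_poly A)) x = 0"
    unfolding pderiv_char_poly[OF A] using root by (simp add: poly_sum)
  moreover have p0: "char_poly A \<noteq> 0"
    using degree_monic_char_poly[OF A] by auto
  moreover have "order x (char_poly A) = 1" using simple by (simp add: simple_eigenvalue_def)
  moreover have "pderiv (char_poly A) \<noteq> 0"
  proof
    assume "pderiv (char_poly A) = 0"
    hence "degree (char_poly A) = 0" by (simp add: pderiv_eq_0_iff)
    thus False using degree_monic_char_poly[OF A] i by simp
  qed
  ultimately show False
    using order_pderiv[of "char_poly A" x] by (auto simp: order_root)
qed

section \<open>Recurrent states\<close>

lemma mat_power_nonneg:
  fixes A :: "real mat"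
  assumes A: "A \<in> carrier_mat n n" and nn: "\<And>i j. i < n \<Longrightarrow> j < n \<Longrightarrow> A $$ (i, j) \<ge> 0"
    and "i < n" "j < n"
  shows "(A ^\<^sub>m m) $$ (i, j) \<ge> 0"
  using assms(3,4)
proof (induction m arbitrary: i j)
  case (Suc m)
  have "(A ^\<^sub>m m) \<in> carrier_mat n n" using A by simp
  thus ?case using A Suc nn by (auto simp: scalar_prod_def intro!: sum_nonneg)
qed (use A in auto)

lemma mat_power_Suc_left:
  fixes A :: "'b :: semiring_1 mat"
  assumes A: "A \<in> carrier_mat n n"
  shows "A ^\<^sub>m Suc m = A * A ^\<^sub>m m"
proof (induction m)
  case (Suc m)
  have "A ^\<^sub>m Suc (Suc m) = (A * A ^\<^sub>m m) * A" using Suc by simp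
  also have "\<dots> = A * A ^\<^sub>m Suc m"
    using assoc_mult_mat[OF A pow_carrier_mat[OF A] A] by simp
  finally show ?case .
qed (use A in auto)

lemma leads_to_step:
  fixes A :: "real mat"
  assumes A: "A \<in> carrier_mat n n" and nn: "\<And>i j. i < n \<Longrightarrow> j < n \<Longrightarrow> A $$ (i, j) \<ge> 0"
    and "i < n" "g < n" "j < n" and pos: "A $$ (i, g) > 0" and lead: "leads_to A g j"
  shows "leads_to A i j"
proof -
  obtain m where m: "(A ^\<^sub>m m) $$ (g, j) > 0" using lead by (auto simp: leads_to_def)
  have Am: "A ^\<^sub>m m \<in> carrier_mat n n" using A by simp
  have "(A ^\<^sub>m Suc m) $$ (i, j) = (\<Sum>h<n. A $$ (i, h) * (A ^\<^sub>m m) $$ (h, j))"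
    using A Am assms unfolding mat_power_Suc_left[OF A]
    by (auto simp: scalar_prod_def lessThan_atLeast0)
  also have "\<dots> \<ge> A $$ (i, g) * (A ^\<^sub>m m) $$ (g, j)"
    using mat_power_nonneg[OF A nn] nn assms
    by (intro member_le_sum[of g _ "\<lambda>h. A $$ (i, h) * (A ^\<^sub>m m) $$ (h, j)"]) auto
  finally show ?thesis using m pos unfolding leads_to_def
    by (metis mult_pos_pos order_less_le_trans)
qed

text \<open>If \<open>h\<close> could not reach \<open>j\<close>, the mass
  \<open>A $$ (j, h)\<close> would be lost at the first step, and the probability of ever returning
  to \<open>j\<close> would stay below 1.\<close>

lemma recurrent_successor_leads_back:
  fixes A :: "real mat"
  assumes A: "A \<in> carrier_mat n n" and nn: "\<And>i j. i < n \<Longrightarrow> j < n \<Longrightarrow> A $$ (i, j) \<ge> 0"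
    and rows: "\<And>i. i < n \<Longrightarrow> (\<Sum>j<n. A $$ (i, j)) = 1"
    and j: "j < n" and h: "h < n" and rec: "recurrent_state A j" and pos: "A $$ (j, h) > 0"
  shows "leads_to A h j"
proof (rule ccontr)
  assume not_lead: "\<not> leads_to A h j"
  have dim: "dim_row A = n" using A by simp
  have "leads_to A j j" using A j unfolding leads_to_def by (intro exI[of _ 0]) auto
  hence hj: "h \<noteq> j" using not_lead by auto
  \<comment> \<open>From a state that does not lead to \<open>j\<close>, every step of positive
    weight goes to another such state.\<close>
  have vanish: "first_passage A m i j = 0" if "i < n" "\<not> leads_to A i j" for m i
    using that
  proof (induction m arbitrary: i)
    case (Suc m)
    have no_step: "A $$ (i, g) = 0" if "g < n" "leads_to A g j" for g
      using leads_to_step[OF A nn _ that(1) j _ that(2)] nn[OF Suc.prems(1) that(1)] Suc.prems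
      by fastforce
    show ?case
    proof (cases m)
      case 0
      thus ?thesis using no_step[OF j \<open>leads_to A j j\<close>] by simp
    next
      case (Suc m')
      have "A $$ (i, g) * first_passage A m g j = 0" if "g < n" for g
        using no_step[OF that] Suc.IH[OF that] by (cases "leads_to A g j") auto
      thus ?thesis using Suc dim by (auto intro!: sum.neutral)
    qed
  qed simp
  \<comment> \<open>The probability of hitting \<open>j\<close> at one of the times 1, ...,
    \<open>m\<close>; the term \<open>t = 0\<close> is zero. \<open>F_Suc\<close> is the analysis of
    the first step.\<close>
  define F where "F m i = (\<Sum>t<Suc m. first_passage A t i j)" for m i
  have F_shift: "F m i = (\<Sum>t<m. first_passage A (Suc t) i j)" for m i
    unfolding F_def by (simp add: sum.lessThan_Suc_shift del: sum.lessThan_Suc)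
  have F_Suc: "F (Suc m) i = A $$ (i, j) + (\<Sum>g\<in>{..<n} - {j}. A $$ (i, g) * F m g)" for m i
  proof -
    have "F (Suc m) i = A $$ (i, j) + (\<Sum>t<m. first_passage A (Suc (Suc t)) i j)"
      unfolding F_shift by (simp add: sum.lessThan_Suc_shift dim del: sum.lessThan_Suc)
    also have "(\<Sum>t<m. first_passage A (Suc (Suc t)) i j)
        = (\<Sum>g\<in>{..<n} - {j}. A $$ (i, g) * (\<Sum>t<m. first_passage A (Suc t) g j))"
      by (simp add: dim sum_distrib_left) (rule sum.swap)
    finally show ?thesis by (simp add: F_shift)
  qed
  have row_split: "A $$ (i, j) + (\<Sum>g\<in>{..<n} - {j}. A $$ (i, g)) = 1" if "i < n" for i
    using rows[OF that] j by (simp add: sum.remove[of "{..<n}" j])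
  have F_le: "F m i \<le> 1" if "i < n" for m i
    using that
  proof (induction m arbitrary: i)
    case (Suc m)
    have "F (Suc m) i \<le> A $$ (i, j) + (\<Sum>g\<in>{..<n} - {j}. A $$ (i, g) * 1)"
      unfolding F_Suc using Suc nn by (intro add_left_mono sum_mono mult_left_mono) auto
    thus ?case using row_split[OF Suc.prems] by simp
  qed (simp add: F_def)
  have F_h: "F m h = 0" for m
    unfolding F_def using vanish[OF h not_lead] by simp
  \<comment> \<open>The summand of \<open>h\<close> vanishes by \<open>F_h\<close>, and the others
    are bounded by their weights.\<close>
  have "F (Suc m) j \<le> 1 - A $$ (j, h)" for m
  proof -
    have "(\<Sum>g\<in>{..<n} - {j}. A $$ (j, g) * F m g)
        = (\<Sum>g\<in>{..<n} - {j} - {h}. A $$ (j, g) * F m g)"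
      using F_h h hj by (simp add: sum.remove[of _ h])
    also have "\<dots> \<le> (\<Sum>g\<in>{..<n} - {j} - {h}. A $$ (j, g) * 1)"
      using F_le nn j by (intro sum_mono mult_left_mono) auto
    also have "\<dots> = (\<Sum>g\<in>{..<n} - {j}. A $$ (j, g)) - A $$ (j, h)"
      using h hj by (simp add: sum.remove[of "{..<n} - {j}" h])
    finally show ?thesis using row_split[OF j] unfolding F_Suc by simp
  qed
  moreover have "(\<lambda>m. F (Suc m) j) \<longlonglongrightarrow> 1"
    using rec unfolding recurrent_state_def sums_def F_def
    by (intro LIMSEQ_Suc)
  ultimately have "1 \<le> 1 - A $$ (j, h)" by (intro LIMSEQ_le_const2) auto
  thus False using pos by simp
qed

section \<open>Averaging recursions for nonexpansive urn maps\<close>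

text \<open>Bolzano-Weierstrass for vectors indexed by a finite set, refining the subsequence for
  one coordinate at a time.\<close>

lemma real_family_convergent_subseq:
  fixes f :: "nat \<Rightarrow> 'i \<Rightarrow> real"
  assumes "finite I" and bdd: "\<And>n a. a \<in> I \<Longrightarrow> \<bar>f n a\<bar> \<le> B"
  obtains s l where "strict_mono (s :: nat \<Rightarrow> nat)" "\<And>a. a \<in> I \<Longrightarrow> (\<lambda>n. f (s n) a) \<longlonglongrightarrow> l a"
proof -
  have "\<exists>s l. strict_mono (s :: nat \<Rightarrow> nat) \<and> (\<forall>a\<in>I. (\<lambda>n. f (s n) a) \<longlonglongrightarrow> l a)"
    using assms
  proof (induction I rule: finite_induct)
    case empty
    show ?case by (intro exI[of _ id]) (auto simp: strict_mono_def)
  next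
    case (insert b I)
    then obtain s l where s: "strict_mono (s :: nat \<Rightarrow> nat)"
      and l: "\<And>a. a \<in> I \<Longrightarrow> (\<lambda>n. f (s n) a) \<longlonglongrightarrow> l a" by blast
    have "\<forall>n. f (s n) b \<in> {-B..B}" using insert.prems[of b] by (auto simp: abs_le_iff minus_le_iff)
    then obtain c t where t: "strict_mono (t :: nat \<Rightarrow> nat)"
      and c: "((\<lambda>n. f (s n) b) \<circ> t) \<longlonglongrightarrow> c"
      using compact_imp_seq_compact[OF compact_Icc[of "-B" B]] unfolding seq_compact_def by metis
    have "(\<lambda>n. f (s (t n)) a) \<longlonglongrightarrow> l a" if "a \<in> I" for a
      using LIMSEQ_subseq_LIMSEQ[OF l[OF that] t] by (simp add: o_def)
    thus ?case
      using c insert.hyps strict_mono_o[OF s t]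
      by (intro exI[of _ "s \<circ> t"] exI[of _ "l(b := c)"]) (auto simp: o_def)
  qed
  thus ?thesis using that by blast
qed

section \<open>Central binomial coefficients and the variation of a binomial row\<close>

text \<open>Consecutive quotients have the ratio \<open>(2 * n + 1) / (2 * n + 2)\<close>, and the
  induction closes because
  \<open>(2 * n + 1) * (2 * n + 3) \<le> (2 * n + 2)\<^sup>2\<close>.\<close>

lemma central_binomial_upper_bound: "(real (2 * n choose n) / 4 ^ n)\<^sup>2 \<le> 1 / (2 * n + 1)"
proof (induction n)
  case (Suc n)
  have a: "Suc n * (2 * Suc n choose Suc n) = 2 * Suc n * (Suc (2 * n) choose n)"
    using Suc_times_binomial_eq[of "Suc (2 * n)" n] by (simp add: mult.commute)
  have b: "(Suc (2 * n) choose n) = (Suc (2 * n) choose Suc n)"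
    using binomial_symmetric[of n "Suc (2 * n)"] by simp
  have c: "Suc n * (Suc (2 * n) choose Suc n) = Suc (2 * n) * (2 * n choose n)"
    using Suc_times_binomial_eq[of "2 * n" n] by (simp add: mult.commute)
  have "Suc n * (2 * Suc n choose Suc n) = 2 * (2 * n + 1) * (2 * n choose n)"
    using a b c by (metis Suc_eq_plus1 mult.assoc mult.left_commute)
  hence rec: "real (Suc n) * (2 * Suc n choose Suc n) = real (2 * (2 * n + 1)) * (2 * n choose n)"
    by (metis of_nat_mult)
  have "x / (4 * q) = (2 * n + 1) / (2 * (n + 1)) * (y / q)"
    if "real (Suc n) * x = real (2 * (2 * n + 1)) * y" "q > 0" for x y q :: real
  proof -
    have x: "x = (2 * (2 * n + 1)) * y / (n + 1)" using that(1) by (simp add: field_simps)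
    show ?thesis unfolding x using that(2) by (simp add: divide_simps) (simp add: algebra_simps)
  qed
  from this[OF rec, of "4 ^ n"] have "real (2 * Suc n choose Suc n) / 4 ^ Suc n
      = (2 * n + 1) / (2 * (n + 1)) * (real (2 * n choose n) / 4 ^ n)"
    by simp
  hence "(real (2 * Suc n choose Suc n) / 4 ^ Suc n)\<^sup>2
      = ((2 * n + 1) / (2 * (n + 1)))\<^sup>2 * (real (2 * n choose n) / 4 ^ n)\<^sup>2"
    by (simp only: power_mult_distrib)
  also have "\<dots> \<le> ((2 * n + 1) / (2 * (n + 1)))\<^sup>2 * (1 / (2 * n + 1))"
    using Suc by (intro mult_left_mono) (simp_all add: add.commute)
  also have "\<dots> = (2 * n + 1) / (2 * (n + 1))\<^sup>2"
  proof -
    have "(x / y)\<^sup>2 * (1 / x) = x / y\<^sup>2" for x y :: real by (simp add: power2_eq_square)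
    from this[of "2 * real n + 1" "2 * (real n + 1)"] show ?thesis by (simp add: algebra_simps)
  qed
  also have "\<dots> \<le> 1 / (2 * Suc n + 1)"
  proof -
    have "(2 * real n + 1) * (2 * real n + 3) \<le> (2 * (real n + 1))\<^sup>2"
      by (simp add: power2_eq_square algebra_simps)
    thus ?thesis by (simp add: field_simps)
  qed
  finally show ?case by simp
qed simp

lemma central_binomial_tendsto_0: "(\<lambda>n. real (2 * n choose n) / 4 ^ n) \<longlonglongrightarrow> 0"
proof -
  have sq: "(\<lambda>n. (real (2 * n choose n) / 4 ^ n)\<^sup>2) \<longlonglongrightarrow> 0"
  proof (rule tendsto_sandwich[OF _ _ tendsto_const])
    show "(\<lambda>n. 1 / (2 * real n + 1)) \<longlonglongrightarrow> 0" by real_asymp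
  qed (use central_binomial_upper_bound in auto)
  show ?thesis using tendsto_real_sqrt[OF sq] by (simp add: tendsto_rabs_zero_iff)
qed

text \<open>The coefficient of \<open>x ^ t\<close> in \<open>(1 - x) * (1 + x) ^ m\<close>. The
  case \<open>t = 0\<close> is separate because \<open>t - 1\<close> is truncated.\<close>

definition binomial_increment :: "nat \<Rightarrow> nat \<Rightarrow> real" where
  "binomial_increment m t = real (m choose t) - (if t = 0 then 0 else real (m choose (t - 1)))"

lemma sum_abs_binomial_increment:
  "(\<Sum>t\<le>Suc (2 * n). \<bar>binomial_increment (2 * n) t\<bar>) = 2 * real (2 * n choose n)"
proof -
  have up: "(\<Sum>t\<le>m. \<bar>binomial_increment (2 * n) t\<bar>) = real (2 * n choose m)" if "m \<le> n" for m
    using that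
  proof (induction m)
    case (Suc m)
    have "2 * n choose m \<le> 2 * n choose Suc m" using Suc.prems by (intro binomial_mono) auto
    thus ?case using Suc by (simp add: binomial_increment_def)
  qed (simp add: binomial_increment_def)
  \<comment> \<open>Beyond the middle the increments are at most 0 and the sum telescopes from the
    central coefficient. It ends at \<open>2 * n + 1\<close>, where the coefficient has dropped to
    0.\<close>
  have down: "(\<Sum>t\<le>n + m. \<bar>binomial_increment (2 * n) t\<bar>)
      = 2 * real (2 * n choose n) - real (2 * n choose (n + m))" for m
  proof (induction m)
    case (Suc m)
    have "2 * n choose Suc (n + m) \<le> 2 * n choose (n + m)"
    proof (cases "Suc (n + m) \<le> 2 * n")
      case True
      thus ?thesis by (intro binomial_antimono) auto
    qed (simp add: binomial_eq_0)
    thus ?case using Suc by (simp add: binomial_increment_def)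
  qed (use up[of n] in simp)
  have "2 * n choose (n + Suc n) = 0" and idx: "n + Suc n = Suc (2 * n)"
    by (simp_all add: binomial_eq_0)
  with down[of "Suc n"] show ?thesis unfolding idx by linarith
qed

text \<open>Since \<open>\<Sum> 1 / (n + 1)\<close> diverges, the steps are large enough to forget the initial value.\<close>

lemma harmonic_contraction_tendsto_0:
  fixes a \<epsilon> :: "nat \<Rightarrow> real"
  assumes c: "c > 0" and nonneg: "\<And>n. a n \<ge> 0" and \<epsilon>: "\<epsilon> \<longlonglongrightarrow> 0"
    and rec: "\<And>n. n \<ge> m0 \<Longrightarrow> a (Suc n) \<le> (1 - c / (real n + 1)) * a n + \<epsilon> n / (real n + 1)"
  shows "a \<longlonglongrightarrow> 0"
proof (rule LIMSEQ_I)
  fix \<eta> :: real assume \<eta>: "\<eta> > 0"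
  define \<theta> where "\<theta> = \<eta> / 2"
  have \<theta>: "\<theta> > 0" using \<eta> by (simp add: \<theta>_def)
  have "eventually (\<lambda>n. \<epsilon> n < c * \<theta>) sequentially"
    using \<epsilon> c \<theta> by (intro order_tendstoD) auto
  then obtain n1 where n1: "\<And>n. n \<ge> n1 \<Longrightarrow> \<epsilon> n \<le> c * \<theta>"
    by (meson eventually_sequentially less_imp_le)
  \<comment> \<open>Beyond \<open>c\<close> the factor \<open>1 - c / (real n + 1)\<close> is
    nonnegative; beyond \<open>n1\<close> the perturbation is at most
    \<open>c * \<theta>\<close>.\<close>
  define m where "m = max (max m0 n1) (nat \<lceil>c\<rceil>)"
  \<comment> \<open>The excess over \<open>\<theta>\<close> satisfies the recursion without
    perturbation: what the contraction takes away from the level \<open>\<theta>\<close> pays for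
    the term with \<open>\<epsilon> n\<close>.\<close>
  define b where "b n = max 0 (a n - \<theta>)" for n
  have b_nonneg: "b n \<ge> 0" for n by (simp add: b_def)
  have contr: "b (Suc n) \<le> (1 - c / (real n + 1)) * b n" if "n \<ge> m" for n
  proof -
    have n: "n \<ge> m0" "n \<ge> n1" "c \<le> n" using that by (auto simp: m_def)
    have pos: "1 - c / (real n + 1) \<ge> 0" using n by (simp add: field_simps)
    have "a (Suc n) - \<theta> \<le> (1 - c / (real n + 1)) * a n + c * \<theta> / (real n + 1) - \<theta>"
      using rec[OF n(1)] divide_right_mono[OF n1[OF n(2)], of "real n + 1"] by simp
    also have "\<dots> = (1 - c / (real n + 1)) * (a n - \<theta>)" by (simp add: algebra_simps diff_divide_distrib)
    also have "\<dots> \<le> (1 - c / (real n + 1)) * b n"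
      using pos by (intro mult_left_mono) (auto simp: b_def)
    finally show ?thesis using pos b_nonneg[of n] by (auto simp: b_def)
  qed
  have "\<exists>n\<ge>m. b n < \<theta>"
  proof (rule ccontr)
    assume "\<not> ?thesis"
    hence big: "b n \<ge> \<theta>" if "n \<ge> m" for n using that by force
    \<comment> \<open>While \<open>b\<close> stays above \<open>\<theta>\<close>, each step lowers
      it by at least \<open>c * \<theta> / (n + 1)\<close>; as \<open>b\<close> is nonnegative, this
      would bound the harmonic series.\<close>
    have tele: "b (m + n) + c * \<theta> * (\<Sum>i<n. 1 / (m + i + 1)) \<le> b m" for n
    proof (induction n)
      case (Suc n)
      have "c * \<theta> / (m + n + 1) \<le> c * b (m + n) / (m + n + 1)"
        using big[of "m + n"] c by (intro divide_right_mono mult_left_mono) auto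
      thus ?case using Suc contr[of "m + n"] by (simp add: algebra_simps)
    qed simp
    have "summable (\<lambda>i. 1 / real (m + i + 1))"
    proof (rule bounded_imp_summable)
      show "(\<Sum>i\<le>n. 1 / real (m + i + 1)) \<le> b m / (c * \<theta>)" for n
        using tele[of "Suc n"] c \<theta> b_nonneg[of "m + Suc n"]
        by (simp add: field_simps lessThan_Suc_atMost del: sum.lessThan_Suc)
    qed auto
    hence "summable (\<lambda>i. inverse (real (Suc (i + m))))"
      by (simp add: inverse_eq_divide add.commute add.left_commute)
    hence "summable (\<lambda>i. inverse (real (i + Suc m)))" by simp
    hence "summable (\<lambda>i. inverse (real i))" by (subst (asm) summable_iff_shift)
    thus False using not_summable_harmonic[where 'a = real] by simp
  qed
  then obtain m' where m': "m' \<ge> m" "b m' < \<theta>" by auto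
  have "b n < \<theta>" if "n \<ge> m'" for n
    using that
  proof (induction n rule: dec_induct)
    case (step n)
    have "b (Suc n) \<le> (1 - c / (real n + 1)) * b n" using contr step m' by simp
    also have "\<dots> \<le> 1 * b n" using c b_nonneg by (intro mult_right_mono) auto
    finally have "b (Suc n) \<le> b n" by simp
    thus ?case using step by simp
  qed (use m' in simp)
  hence "a n - \<theta> < \<theta>" if "n \<ge> m'" for n
    using that unfolding b_def by (meson max_less_iff_conj)
  hence "norm (a n - 0) < \<eta>" if "n \<ge> m'" for n
    using that nonneg[of n] by (fastforce simp: \<theta>_def)
  thus "\<exists>no. \<forall>n\<ge>no. norm (a n - 0) < \<eta>" by blast
qed


section \<open>The mean operator of a closed class and its powers\<close>

locale urn_mean_map =
  fixes S :: "'j set" and K :: nat and w :: "'j \<Rightarrow> 'j \<Rightarrow> real" and H :: "'j \<Rightarrow> nat \<Rightarrow> nat \<Rightarrow> real"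
  assumes fin: "finite S" and ne: "S \<noteq> {}" and K_pos: "K > 0"
    and w_nonneg: "\<And>j h. j \<in> S \<Longrightarrow> h \<in> S \<Longrightarrow> w j h \<ge> 0"
    and w_sum: "\<And>j. j \<in> S \<Longrightarrow> (\<Sum>h\<in>S. w j h) = 1"
    and H_nonneg: "\<And>j k i. j \<in> S \<Longrightarrow> k < K \<Longrightarrow> i < K \<Longrightarrow> H j k i \<ge> 0"
    and H_sum: "\<And>j i. j \<in> S \<Longrightarrow> i < K \<Longrightarrow> (\<Sum>k<K. H j k i) = 1"
begin

text \<open>The matrix \<open>joint_Q\<close> of a closed class, acting on functions of urn and
  color instead of stacked vectors. Only values on \<open>S\<close> and below \<open>K\<close>
  matter, whence the congruence lemmas.\<close>

definition Q :: "('j \<Rightarrow> nat \<Rightarrow> real) \<Rightarrow> 'j \<Rightarrow> nat \<Rightarrow> real" where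
  "Q x j k = (\<Sum>i<K. H j k i * (\<Sum>h\<in>S. w j h * x h i))"

definition R :: "('j \<Rightarrow> nat \<Rightarrow> real) \<Rightarrow> 'j \<Rightarrow> nat \<Rightarrow> real" where
  "R x j k = (x j k + Q x j k) / 2"

text \<open>The two parts of the norm match the two factors of \<open>Q\<close>: columns of
  \<open>H j\<close> summing to 1 do not increase the l1-norm over the colors, rows of
  \<open>w\<close> summing to 1 do not increase the maximum over the urns.\<close>

definition p :: "('j \<Rightarrow> nat \<Rightarrow> real) \<Rightarrow> real" where
  "p x = Max ((\<lambda>j. \<Sum>k<K. \<bar>x j k\<bar>) ` S)"

lemma p_ge: "j \<in> S \<Longrightarrow> (\<Sum>k<K. \<bar>x j k\<bar>) \<le> p x"
  unfolding p_def using fin by (intro Max_ge) auto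

lemma p_leI: "(\<And>j. j \<in> S \<Longrightarrow> (\<Sum>k<K. \<bar>x j k\<bar>) \<le> c) \<Longrightarrow> p x \<le> c"
  unfolding p_def using fin ne by (subst Max_le_iff) auto

lemma p_nonneg: "p x \<ge> 0"
proof -
  obtain j where "j \<in> S" using ne by blast
  thus ?thesis using p_ge[of j x] by (meson abs_ge_zero order_trans sum_nonneg)
qed

lemma abs_le_p: "j \<in> S \<Longrightarrow> k < K \<Longrightarrow> \<bar>x j k\<bar> \<le> p x"
  by (rule order.trans[OF member_le_sum[of k "{..<K}" "\<lambda>k. \<bar>x j k\<bar>"] p_ge[of j x]]) auto

lemma p_le_sum: "p x \<le> (\<Sum>j\<in>S. \<Sum>k<K. \<bar>x j k\<bar>)"
proof (rule p_leI)
  fix j assume "j \<in> S"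
  thus "(\<Sum>k<K. \<bar>x j k\<bar>) \<le> (\<Sum>j\<in>S. \<Sum>k<K. \<bar>x j k\<bar>)"
    using fin by (intro member_le_sum[of j S "\<lambda>j. \<Sum>k<K. \<bar>x j k\<bar>"]) (auto intro: sum_nonneg)
qed

lemma p_cong: "(\<And>j k. j \<in> S \<Longrightarrow> k < K \<Longrightarrow> x j k = y j k) \<Longrightarrow> p x = p y"
  unfolding p_def by (simp cong: image_cong)

lemma p_comb: "p (\<lambda>j k. a * x j k + b * y j k) \<le> \<bar>a\<bar> * p x + \<bar>b\<bar> * p y"
proof (rule p_leI)
  fix j assume j: "j \<in> S"
  have "(\<Sum>k<K. \<bar>a * x j k + b * y j k\<bar>) \<le> (\<Sum>k<K. \<bar>a\<bar> * \<bar>x j k\<bar> + \<bar>b\<bar> * \<bar>y j k\<bar>)"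
    by (intro sum_mono order.trans[OF abs_triangle_ineq]) (simp add: abs_mult)
  also have "\<dots> = \<bar>a\<bar> * (\<Sum>k<K. \<bar>x j k\<bar>) + \<bar>b\<bar> * (\<Sum>k<K. \<bar>y j k\<bar>)"
    by (simp add: sum.distrib sum_distrib_left)
  also have "\<dots> \<le> \<bar>a\<bar> * p x + \<bar>b\<bar> * p y"
    using p_ge[OF j] by (intro add_mono mult_left_mono) auto
  finally show "(\<Sum>k<K. \<bar>a * x j k + b * y j k\<bar>) \<le> \<bar>a\<bar> * p x + \<bar>b\<bar> * p y" .
qed

lemma p_sum:
  assumes "finite T"
  shows "p (\<lambda>j k. \<Sum>t\<in>T. c t * x t j k) \<le> (\<Sum>t\<in>T. \<bar>c t\<bar> * p (x t))"
proof (rule p_leI)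
  fix j assume j: "j \<in> S"
  have "(\<Sum>k<K. \<bar>\<Sum>t\<in>T. c t * x t j k\<bar>) \<le> (\<Sum>k<K. \<Sum>t\<in>T. \<bar>c t\<bar> * \<bar>x t j k\<bar>)"
    by (intro sum_mono order.trans[OF sum_abs]) (simp add: abs_mult)
  also have "\<dots> = (\<Sum>t\<in>T. \<bar>c t\<bar> * (\<Sum>k<K. \<bar>x t j k\<bar>))"
    by (subst sum.swap) (simp add: sum_distrib_left)
  also have "\<dots> \<le> (\<Sum>t\<in>T. \<bar>c t\<bar> * p (x t))"
    using p_ge[OF j] by (intro sum_mono mult_left_mono) auto
  finally show "(\<Sum>k<K. \<bar>\<Sum>t\<in>T. c t * x t j k\<bar>) \<le> (\<Sum>t\<in>T. \<bar>c t\<bar> * p (x t))" .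
qed

lemma Q_cong:
  assumes "\<And>j k. j \<in> S \<Longrightarrow> k < K \<Longrightarrow> x j k = y j k"
  shows "Q x = Q y"
proof (intro ext)
  fix j k
  have "(\<Sum>h\<in>S. w j h * x h i) = (\<Sum>h\<in>S. w j h * y h i)" if "i < K" for i
    using assms that by (intro sum.cong) auto
  thus "Q x j k = Q y j k" by (simp add: Q_def)
qed

lemma Q_comb: "Q (\<lambda>j k. a * x j k + b * y j k) = (\<lambda>j k. a * Q x j k + b * Q y j k)"
  by (intro ext) (simp add: Q_def sum.distrib sum_distrib_left algebra_simps)

lemma Q_sum: "Q (\<lambda>j k. \<Sum>t\<in>T. c t * x t j k) = (\<lambda>j k. \<Sum>t\<in>T. c t * Q (x t) j k)"
proof (intro ext)
  fix j k
  have "Q (\<lambda>j k. \<Sum>t\<in>T. c t * x t j k) j k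
      = (\<Sum>i<K. \<Sum>h\<in>S. \<Sum>t\<in>T. c t * (H j k i * (w j h * x t h i)))"
    by (simp add: Q_def sum_distrib_left mult_ac)
  also have "\<dots> = (\<Sum>i<K. \<Sum>t\<in>T. \<Sum>h\<in>S. c t * (H j k i * (w j h * x t h i)))"
    by (intro sum.cong refl sum.swap)
  also have "\<dots> = (\<Sum>t\<in>T. \<Sum>i<K. \<Sum>h\<in>S. c t * (H j k i * (w j h * x t h i)))"
    by (rule sum.swap)
  finally show "Q (\<lambda>j k. \<Sum>t\<in>T. c t * x t j k) j k = (\<Sum>t\<in>T. c t * Q (x t) j k)"
    by (simp add: Q_def sum_distrib_left)
qed

lemma Q_urn_sum:
  assumes j: "j \<in> S"
  shows "(\<Sum>k<K. Q x j k) = (\<Sum>h\<in>S. w j h * (\<Sum>i<K. x h i))"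
proof -
  have "(\<Sum>k<K. Q x j k) = (\<Sum>i<K. (\<Sum>k<K. H j k i) * (\<Sum>h\<in>S. w j h * x h i))"
    unfolding Q_def by (subst sum.swap) (simp add: sum_distrib_right)
  also have "\<dots> = (\<Sum>i<K. \<Sum>h\<in>S. w j h * x h i)" using H_sum[OF j] by simp
  also have "\<dots> = (\<Sum>h\<in>S. w j h * (\<Sum>i<K. x h i))"
    by (subst sum.swap) (simp add: sum_distrib_left)
  finally show ?thesis .
qed

text \<open>As the entries of \<open>Q\<close> are nonnegative, absolute values may be moved inside;
  then \<open>Q_urn_sum\<close> turns the l1-norm of an urn into a weighted mean of such
  norms.\<close>

lemma p_Q: "p (Q x) \<le> p x"
proof (rule p_leI)
  fix j assume j: "j \<in> S"
  have "(\<Sum>k<K. \<bar>Q x j k\<bar>) \<le> (\<Sum>k<K. Q (\<lambda>h i. \<bar>x h i\<bar>) j k)"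
  proof (intro sum_mono)
    fix k assume "k \<in> {..<K}"
    hence k: "k < K" by simp
    have "\<bar>Q x j k\<bar> \<le> (\<Sum>i<K. \<bar>H j k i\<bar> * (\<Sum>h\<in>S. \<bar>w j h * x h i\<bar>))"
      unfolding Q_def by (intro order.trans[OF sum_abs] sum_mono)
        (auto simp: abs_mult intro!: mult_left_mono order.trans[OF sum_abs])
    also have "\<dots> = Q (\<lambda>h i. \<bar>x h i\<bar>) j k"
      unfolding Q_def using H_nonneg[OF j k] w_nonneg[OF j]
      by (intro sum.cong refl arg_cong2[of _ _ _ _ "(*)"]) (auto simp: abs_mult)
    finally show "\<bar>Q x j k\<bar> \<le> Q (\<lambda>h i. \<bar>x h i\<bar>) j k" .
  qed
  also have "\<dots> = (\<Sum>h\<in>S. w j h * (\<Sum>i<K. \<bar>x h i\<bar>))" by (rule Q_urn_sum[OF j])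
  also have "\<dots> \<le> (\<Sum>h\<in>S. w j h * p x)"
    using w_nonneg[OF j] p_ge by (intro sum_mono mult_left_mono) auto
  also have "\<dots> = p x" using w_sum[OF j] by (simp flip: sum_distrib_right)
  finally show "(\<Sum>k<K. \<bar>Q x j k\<bar>) \<le> p x" .
qed

lemma p_Q_pow: "p ((Q ^^ t) x) \<le> p x"
proof (induction t)
  case (Suc t)
  show ?case using order.trans[OF p_Q Suc] by simp
qed simp

lemma R_comb: "R (\<lambda>j k. a * x j k + b * y j k) = (\<lambda>j k. a * R x j k + b * R y j k)"
  unfolding R_def Q_comb by (simp add: algebra_simps add_divide_distrib)

lemma R_sum: "R (\<lambda>j k. \<Sum>t\<in>T. c t * x t j k) = (\<lambda>j k. \<Sum>t\<in>T. c t * R (x t) j k)"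
  unfolding R_def Q_sum sum.distrib[symmetric] sum_divide_distrib distrib_left[symmetric]
  by simp

lemma R_cong:
  "(\<And>j k. j \<in> S \<Longrightarrow> k < K \<Longrightarrow> x j k = y j k) \<Longrightarrow> j \<in> S \<Longrightarrow> k < K \<Longrightarrow> R x j k = R y j k"
  using Q_cong[of x y] by (simp add: R_def)

lemma R_pow_cong:
  "(\<And>j k. j \<in> S \<Longrightarrow> k < K \<Longrightarrow> x j k = y j k) \<Longrightarrow> j \<in> S \<Longrightarrow> k < K \<Longrightarrow> (R ^^ t) x j k = (R ^^ t) y j k"
proof (induction t arbitrary: j k)
  case (Suc t)
  show ?case using R_cong[of "(R ^^ t) x" "(R ^^ t) y"] Suc by simp
qed auto

lemma R_pow_comb:
  "(R ^^ t) (\<lambda>j k. a * x j k + b * y j k) = (\<lambda>j k. a * (R ^^ t) x j k + b * (R ^^ t) y j k)"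
  by (induction t) (simp_all add: R_comb)

lemma R_pow_sum:
  "(R ^^ m) (\<lambda>j k. \<Sum>t\<in>T. c t * x t j k) = (\<lambda>j k. \<Sum>t\<in>T. c t * (R ^^ m) (x t) j k)"
  by (induction m) (simp_all add: R_sum)

lemma p_R: "p (R x) \<le> p x"
proof -
  have "R x = (\<lambda>j k. 1 / 2 * x j k + 1 / 2 * Q x j k)"
    by (intro ext) (simp add: R_def field_simps)
  hence "p (R x) \<le> \<bar>1 / 2\<bar> * p x + \<bar>1 / 2\<bar> * p (Q x)"
    using p_comb[of "1 / 2" x "1 / 2" "Q x"] by (simp only:)
  thus ?thesis using p_Q[of x] by simp
qed

lemma p_R_pow: "p ((R ^^ t) x) \<le> p x"
proof (induction t)
  case (Suc t)
  show ?case using order.trans[OF p_R Suc] by simp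
qed simp

lemma R_pow_urn_sum:
  assumes "\<And>j. j \<in> S \<Longrightarrow> (\<Sum>k<K. x j k) = c" and "j \<in> S"
  shows "(\<Sum>k<K. (R ^^ t) x j k) = c"
  using assms(2)
proof (induction t arbitrary: j)
  case (Suc t)
  have "(\<Sum>k<K. Q ((R ^^ t) x) j k) = c"
    using Suc w_sum[of j] by (simp add: Q_urn_sum flip: sum_distrib_right)
  moreover have "(R ^^ Suc t) x j k = ((R ^^ t) x j k + Q ((R ^^ t) x) j k) / 2" for k
    by (simp add: R_def)
  hence "(\<Sum>k<K. (R ^^ Suc t) x j k)
      = ((\<Sum>k<K. (R ^^ t) x j k) + (\<Sum>k<K. Q ((R ^^ t) x) j k)) / 2"
    by (simp only: sum.distrib[symmetric] sum_divide_distrib)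
  ultimately show ?case using Suc by simp
qed (use assms in simp)

lemma R_pow_binomial: "(R ^^ m) x j k = (\<Sum>t\<le>m. real (m choose t) * (Q ^^ t) x j k) / 2 ^ m"
proof (induction m arbitrary: j k)
  case (Suc m)
  define y where "y t = (Q ^^ t) x j k" for t
  have eq: "(R ^^ m) x = (\<lambda>j k. \<Sum>t\<le>m. (real (m choose t) / 2 ^ m) * (Q ^^ t) x j k)"
    by (intro ext) (simp add: Suc sum_divide_distrib)
  have "(\<Sum>t\<le>Suc m. real (Suc m choose t) * y t)
      = y 0 + (\<Sum>t\<le>m. (real (m choose t) + real (m choose Suc t)) * y (Suc t))"
    by (simp add: sum.atMost_Suc_shift del: sum.atMost_Suc)
  also have "\<dots> = (\<Sum>t\<le>m. real (m choose t) * y (Suc t))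
      + (y 0 + (\<Sum>t\<le>m. real (m choose Suc t) * y (Suc t)))"
    by (simp add: algebra_simps sum.distrib)
  also have "y 0 + (\<Sum>t\<le>m. real (m choose Suc t) * y (Suc t))
      = (\<Sum>t\<le>Suc m. real (m choose t) * y t)"
    by (simp add: sum.atMost_Suc_shift del: sum.atMost_Suc)
  also have "\<dots> = (\<Sum>t\<le>m. real (m choose t) * y t)" by (simp add: binomial_eq_0)
  finally have binom: "(\<Sum>t\<le>Suc m. real (Suc m choose t) * y t)
      = (\<Sum>t\<le>m. real (m choose t) * y (Suc t)) + (\<Sum>t\<le>m. real (m choose t) * y t)" .
  have "(R ^^ Suc m) x j k = ((R ^^ m) x j k + Q ((R ^^ m) x) j k) / 2" by (simp add: R_def)
  also have "\<dots> = ((\<Sum>t\<le>m. real (m choose t) * y t) / 2 ^ m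
      + (\<Sum>t\<le>m. real (m choose t) * y (Suc t)) / 2 ^ m) / 2"
    unfolding eq Q_sum by (simp add: y_def sum_divide_distrib)
  finally show ?case using binom unfolding y_def by (simp add: add_divide_distrib add.commute)
qed simp

text \<open>The expansion of \<open>(I - Q) * (I + Q) ^ m\<close> in powers of \<open>Q\<close>,
  divided by \<open>2 ^ m\<close>. Multiplying by \<open>Q\<close> shifts the coefficients, so the
  degree is \<open>m + 1\<close>.\<close>

lemma R_pow_minus_Q:
  "(R ^^ m) x j k - Q ((R ^^ m) x) j k
    = (\<Sum>t\<le>Suc m. (binomial_increment m t / 2 ^ m) * (Q ^^ t) x j k)"
proof -
  define y where "y t = (Q ^^ t) x j k" for t
  have eq: "(R ^^ m) x = (\<lambda>j k. \<Sum>t\<le>m. (real (m choose t) / 2 ^ m) * (Q ^^ t) x j k)"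
    by (intro ext) (simp add: R_pow_binomial sum_divide_distrib)
  have 1: "(R ^^ m) x j k = (\<Sum>t\<le>Suc m. (real (m choose t) / 2 ^ m) * y t)"
    by (simp add: eq y_def binomial_eq_0)
  have 2: "Q ((R ^^ m) x) j k = (\<Sum>t\<le>m. (real (m choose t) / 2 ^ m) * y (Suc t))"
    unfolding eq Q_sum by (simp add: y_def)
  have "\<dots> = (\<Sum>t\<le>Suc m. ((if t = 0 then 0 else real (m choose (t - 1))) / 2 ^ m) * y t)"
    by (simp add: sum.atMost_Suc_shift del: sum.atMost_Suc)
  thus ?thesis unfolding 1 2 y_def
    by (simp add: binomial_increment_def diff_divide_distrib left_diff_distrib sum_subtractf
        del: sum.atMost_Suc)
qed

text \<open>The binomial coefficients \<open>m choose t\<close> are unimodal in \<open>t\<close>, hence their increments add up, in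
  absolute value, to twice the central one, which is small compared with \<open>2 ^ m\<close>.\<close>

lemma R_pow_asymptotically_regular:
  "(\<lambda>n. p (\<lambda>j k. (R ^^ (2 * n)) x j k - Q ((R ^^ (2 * n)) x) j k)) \<longlonglongrightarrow> 0"
proof (rule tendsto_sandwich[OF _ _ tendsto_const])
  \<comment> \<open>An even exponent makes the maximal coefficient the central one, and every power
    of \<open>Q\<close> has norm at most 1.\<close>
  have "p (\<lambda>j k. (R ^^ (2 * n)) x j k - Q ((R ^^ (2 * n)) x) j k)
      \<le> 2 * p x * (real (2 * n choose n) / 4 ^ n)" for n
  proof -
    have "p (\<lambda>j k. (R ^^ (2 * n)) x j k - Q ((R ^^ (2 * n)) x) j k)
        \<le> (\<Sum>t\<le>Suc (2 * n). \<bar>binomial_increment (2 * n) t / 2 ^ (2 * n)\<bar> * p ((Q ^^ t) x))"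
      unfolding R_pow_minus_Q by (rule p_sum) simp
    also have "\<dots> \<le> (\<Sum>t\<le>Suc (2 * n). \<bar>binomial_increment (2 * n) t / 2 ^ (2 * n)\<bar> * p x)"
      using p_Q_pow by (intro sum_mono mult_left_mono) auto
    also have "\<dots> = (\<Sum>t\<le>Suc (2 * n). \<bar>binomial_increment (2 * n) t\<bar>) / 2 ^ (2 * n) * p x"
      by (simp add: sum_distrib_right sum_divide_distrib del: sum.atMost_Suc)
    also have "\<dots> = 2 * p x * (real (2 * n choose n) / 4 ^ n)"
      unfolding sum_abs_binomial_increment power_mult by simp
    finally show ?thesis .
  qed
  thus "\<forall>\<^sub>F n in sequentially. p (\<lambda>j k. (R ^^ (2 * n)) x j k - Q ((R ^^ (2 * n)) x) j k)
      \<le> 2 * p x * (real (2 * n choose n) / 4 ^ n)" by simp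
  show "(\<lambda>n. 2 * p x * (real (2 * n choose n) / 4 ^ n)) \<longlonglongrightarrow> 0"
    using tendsto_mult_right_zero[OF central_binomial_tendsto_0] by blast
qed (simp add: p_nonneg)

lemma Q_tendsto:
  assumes "\<And>j k. j \<in> S \<Longrightarrow> k < K \<Longrightarrow> ((\<lambda>n. x n j k) \<longlongrightarrow> l j k) F"
  shows "((\<lambda>n. Q (x n) j k) \<longlongrightarrow> Q l j k) F"
  unfolding Q_def using assms by (intro tendsto_sum tendsto_mult tendsto_const) auto

text \<open>Nonexpansiveness keeps the orbit bounded, so a subsequence converges. By asymptotic
  regularity and continuity of \<open>Q\<close> its limit is fixed, and the urn sums pass to the
  limit.\<close>

lemma R_pow_limit_point:
  assumes sum: "\<And>j. j \<in> S \<Longrightarrow> (\<Sum>k<K. x j k) = c"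
  obtains s l where "strict_mono (s :: nat \<Rightarrow> nat)"
    and "\<And>j k. j \<in> S \<Longrightarrow> k < K \<Longrightarrow> (\<lambda>n. (R ^^ (2 * s n)) x j k) \<longlonglongrightarrow> l j k"
    and "\<And>j k. j \<in> S \<Longrightarrow> k < K \<Longrightarrow> Q l j k = l j k"
    and "\<And>j. j \<in> S \<Longrightarrow> (\<Sum>k<K. l j k) = c"
proof -
  define I where "I = S \<times> {..<K}"
  have "finite I" using fin by (simp add: I_def)
  moreover have "\<bar>(R ^^ (2 * n)) x (fst a) (snd a)\<bar> \<le> p x" if "a \<in> I" for n a
    using that order.trans[OF abs_le_p p_R_pow] by (auto simp: I_def)
  ultimately obtain s l where s: "strict_mono (s :: nat \<Rightarrow> nat)"
    and "\<And>a. a \<in> I \<Longrightarrow> (\<lambda>n. (R ^^ (2 * s n)) x (fst a) (snd a)) \<longlonglongrightarrow> l a"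
    using real_family_convergent_subseq[of I "\<lambda>n a. (R ^^ (2 * n)) x (fst a) (snd a)" "p x"]
    by blast
  hence l: "(\<lambda>n. (R ^^ (2 * s n)) x j k) \<longlonglongrightarrow> curry l j k" if "j \<in> S" "k < K" for j k
    using that unfolding I_def by fastforce
  have fixed: "Q (curry l) j k = curry l j k" if j: "j \<in> S" and k: "k < K" for j k
  proof -
    have "(\<lambda>n. p (\<lambda>j k. (R ^^ (2 * s n)) x j k - Q ((R ^^ (2 * s n)) x) j k)) \<longlonglongrightarrow> 0"
      using LIMSEQ_subseq_LIMSEQ[OF R_pow_asymptotically_regular s] by (simp add: o_def)
    hence "(\<lambda>n. (R ^^ (2 * s n)) x j k - Q ((R ^^ (2 * s n)) x) j k) \<longlonglongrightarrow> 0"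
      by (rule Lim_null_comparison[rotated])
        (use abs_le_p[OF j k, of "\<lambda>j k. (R ^^ (2 * s _)) x j k - Q ((R ^^ (2 * s _)) x) j k"] in simp)
    moreover have "(\<lambda>n. (R ^^ (2 * s n)) x j k - Q ((R ^^ (2 * s n)) x) j k)
        \<longlonglongrightarrow> curry l j k - Q (curry l) j k"
      using l j k by (intro tendsto_diff Q_tendsto) auto
    ultimately show ?thesis using LIMSEQ_unique by fastforce
  qed
  have "(\<Sum>k<K. curry l j k) = c" if j: "j \<in> S" for j
  proof -
    have "(\<lambda>n. \<Sum>k<K. (R ^^ (2 * s n)) x j k) \<longlonglongrightarrow> (\<Sum>k<K. curry l j k)"
      using l j by (intro tendsto_sum) auto
    thus ?thesis using R_pow_urn_sum[OF sum j] LIMSEQ_unique[OF tendsto_const] by fastforce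
  qed
  with s l fixed show ?thesis by (rule that)
qed

text \<open>The uniform composition serves as a starting vector with urn sums 1; compactness takes
  the place of a Perron-Frobenius argument.\<close>

lemma fixed_point_exists:
  obtains V where "\<And>j k. j \<in> S \<Longrightarrow> k < K \<Longrightarrow> Q V j k = V j k" and "\<And>j. j \<in> S \<Longrightarrow> (\<Sum>k<K. V j k) = 1"
proof -
  have "(\<Sum>k<K. 1 / real K) = 1" using K_pos by simp
  from R_pow_limit_point[of "\<lambda>_ _. 1 / K" 1, OF this]
  obtain l where "\<And>j k. j \<in> S \<Longrightarrow> k < K \<Longrightarrow> Q l j k = l j k" "\<And>j. j \<in> S \<Longrightarrow> (\<Sum>k<K. l j k) = 1"
    by metis
  thus ?thesis by (rule that)
qed

section \<open>Contraction on vectors with vanishing urn sums\<close>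

text \<open>The form in which the simplicity of the eigenvalue enters: 1 is not an eigenvalue on the
  invariant subspace of vectors with vanishing urn sums.\<close>

definition regular :: bool where
  "regular \<longleftrightarrow> (\<forall>z. (\<forall>j\<in>S. (\<Sum>k<K. z j k) = 0) \<longrightarrow> (\<forall>j\<in>S. \<forall>k<K. Q z j k = z j k) \<longrightarrow>
     (\<forall>j\<in>S. \<forall>k<K. z j k = 0))"

text \<open>The limit point of the orbit is fixed and has vanishing urn sums, so it is 0. Since the
  norms along the orbit decrease, convergence along a subsequence is convergence.\<close>

lemma R_pow_tendsto_0:
  assumes reg: regular and sum: "\<And>j. j \<in> S \<Longrightarrow> (\<Sum>k<K. z j k) = 0"
  shows "(\<lambda>n. p ((R ^^ (2 * n)) z)) \<longlonglongrightarrow> 0"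
proof -
  obtain s l where s: "strict_mono (s :: nat \<Rightarrow> nat)"
    and lim: "\<And>j k. j \<in> S \<Longrightarrow> k < K \<Longrightarrow> (\<lambda>n. (R ^^ (2 * s n)) z j k) \<longlonglongrightarrow> l j k"
    and l: "\<And>j k. j \<in> S \<Longrightarrow> k < K \<Longrightarrow> Q l j k = l j k"
    and l_sum: "\<And>j. j \<in> S \<Longrightarrow> (\<Sum>k<K. l j k) = 0"
    using R_pow_limit_point[of z 0, OF sum] by metis
  have l0: "l j k = 0" if "j \<in> S" "k < K" for j k
    using reg l l_sum that unfolding regular_def by blast
  have "(\<lambda>n. \<Sum>j\<in>S. \<Sum>k<K. \<bar>(R ^^ (2 * s n)) z j k\<bar>) \<longlonglongrightarrow> (\<Sum>j\<in>S. \<Sum>k<K. \<bar>0\<bar>)"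
  proof (intro tendsto_sum tendsto_rabs)
    fix j k assume "j \<in> S" "k \<in> {..<K}"
    thus "(\<lambda>n. (R ^^ (2 * s n)) z j k) \<longlonglongrightarrow> 0" using lim[of j k] l0[of j k] by simp
  qed
  hence sub: "(\<lambda>n. p ((R ^^ (2 * s n)) z)) \<longlonglongrightarrow> 0"
    by (rule metric_tendsto_imp_tendsto[where b = 0 and a = "\<Sum>j\<in>S. \<Sum>k<K. \<bar>0\<bar>"])
      (simp_all add: p_nonneg order.trans[OF p_le_sum abs_ge_self])
  have "decseq (\<lambda>n. p ((R ^^ (2 * n)) z))"
    by (intro decseq_SucI) (auto intro: order.trans[OF p_R p_R])
  then obtain L where L: "(\<lambda>n. p ((R ^^ (2 * n)) z)) \<longlonglongrightarrow> L"
    using decseq_convergent[of _ 0] p_nonneg by blast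
  have "(\<lambda>n. p ((R ^^ (2 * s n)) z)) \<longlonglongrightarrow> L"
    using LIMSEQ_subseq_LIMSEQ[OF L s] by (simp add: o_def)
  with sub have "L = 0" using LIMSEQ_unique by blast
  thus ?thesis using L by simp
qed

text \<open>Convergence at each vector becomes uniform because finitely many vectors span the
  subspace.\<close>

lemma R_pow_contracts:
  assumes reg: regular
  obtains m where "m > 0"
    "\<And>z. (\<And>j. j \<in> S \<Longrightarrow> (\<Sum>k<K. z j k) = 0) \<Longrightarrow> p ((R ^^ m) z) \<le> p z / 2"
proof -
  define I where "I = S \<times> {..<K}"
  have finI: "finite I" using fin by (simp add: I_def)
  \<comment> \<open>In the urn \<open>fst a\<close>, the unit vector of color \<open>snd a\<close>
    minus that of color 0; in the other urns, zero.\<close>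
  define e :: "'j \<times> nat \<Rightarrow> 'j \<Rightarrow> nat \<Rightarrow> real"
    where "e a j k = of_bool (j = fst a) * (of_bool (k = snd a) - of_bool (k = 0))" for a j k
  have delta: "(\<Sum>i<K. f i * of_bool (c = i)) = (f c :: real)" if "c < K" for f c
  proof -
    have "(\<Sum>i<K. f i * of_bool (c = i)) = (\<Sum>i<K. if c = i then f i else 0)"
      by (intro sum.cong) auto
    thus ?thesis using that by simp
  qed
  have e_sum: "(\<Sum>k<K. e a j k) = 0" if "a \<in> I" for a j
  proof -
    have "(\<Sum>k<K. e a j k) = of_bool (j = fst a)
        * ((\<Sum>k<K. 1 * of_bool (snd a = k)) - (\<Sum>k<K. 1 * of_bool (0 = k)))"
      unfolding sum_subtractf[symmetric] sum_distrib_left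
      by (intro sum.cong) (auto simp: e_def)
    also have "\<dots> = 0"
      using that K_pos delta[of "snd a" "\<lambda>_. 1"] delta[of 0 "\<lambda>_. 1"] by (auto simp: I_def)
    finally show ?thesis .
  qed
  \<comment> \<open>The coefficients of \<open>z\<close> in this family are its own entries, each at
    most \<open>p z\<close>; so a total norm below 1/2 suffices.\<close>
  have "(\<lambda>n. \<Sum>a\<in>I. p ((R ^^ (2 * n)) (e a))) \<longlonglongrightarrow> (\<Sum>a\<in>I. 0)"
    using e_sum by (intro tendsto_sum R_pow_tendsto_0[OF reg]) auto
  hence "\<forall>\<^sub>F n in sequentially. (\<Sum>a\<in>I. p ((R ^^ (2 * n)) (e a))) < 1 / 2"
    by (rule order_tendstoD) simp
  hence "\<forall>\<^sub>F n in sequentially. (\<Sum>a\<in>I. p ((R ^^ (2 * n)) (e a))) < 1 / 2 \<and> n > 0"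
    using eventually_gt_at_top by (rule eventually_conj)
  then obtain n where n: "(\<Sum>a\<in>I. p ((R ^^ (2 * n)) (e a))) < 1 / 2" "n > 0"
    using eventually_happens'[OF sequentially_bot] by blast
  have "p ((R ^^ (2 * n)) z) \<le> p z / 2" if z: "\<And>j. j \<in> S \<Longrightarrow> (\<Sum>k<K. z j k) = 0" for z
  proof -
    \<comment> \<open>The corrections at color 0 add up to the urn sum of \<open>z\<close>, which is
      zero.\<close>
    have "z j k = (\<Sum>a\<in>I. z (fst a) (snd a) * e a j k)" if j: "j \<in> S" and k: "k < K" for j k
    proof -
      have "(\<Sum>a\<in>I. z (fst a) (snd a) * e a j k) = (\<Sum>h\<in>S. \<Sum>i<K. z h i * e (h, i) j k)"
        by (simp add: I_def sum.cartesian_product case_prod_beta)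
      also have "\<dots> = (\<Sum>h\<in>S. if j = h then z h k else 0)"
      proof (intro sum.cong refl)
        fix h assume h: "h \<in> S"
        have "(\<Sum>i<K. z h i * e (h, i) j k)
            = (\<Sum>i<K. of_bool (j = h) * (z h i * of_bool (k = i) - of_bool (k = 0) * z h i))"
          by (intro sum.cong) (auto simp: e_def algebra_simps)
        also have "\<dots> = of_bool (j = h)
            * ((\<Sum>i<K. z h i * of_bool (k = i)) - of_bool (k = 0) * (\<Sum>i<K. z h i))"
          by (simp only: sum_distrib_left sum_subtractf[symmetric])
        also have "\<dots> = (if j = h then z h k else 0)" using z[OF h] delta[OF k, of "z h"] by simp
        finally show "(\<Sum>i<K. z h i * e (h, i) j k) = (if j = h then z h k else 0)" .
      qed
      also have "\<dots> = z j k" using fin j by simp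
      finally show ?thesis by simp
    qed
    hence "p ((R ^^ (2 * n)) z) = p ((R ^^ (2 * n)) (\<lambda>j k. \<Sum>a\<in>I. z (fst a) (snd a) * e a j k))"
      by (intro p_cong R_pow_cong) auto
    also have "\<dots> \<le> (\<Sum>a\<in>I. \<bar>z (fst a) (snd a)\<bar> * p ((R ^^ (2 * n)) (e a)))"
      unfolding R_pow_sum by (rule p_sum[OF finI])
    also have "\<dots> \<le> (\<Sum>a\<in>I. p z * p ((R ^^ (2 * n)) (e a)))"
      by (intro sum_mono mult_right_mono abs_le_p p_nonneg) (auto simp: I_def)
    also have "\<dots> \<le> p z * (1 / 2)"
      unfolding sum_distrib_left[symmetric] by (intro mult_left_mono less_imp_le[OF n(1)] p_nonneg)
    finally show ?thesis by simp
  qed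
  with n(2) show ?thesis using that[of "2 * n"] by simp
qed

text \<open>With \<open>m\<close> such that \<open>R ^^ m\<close> halves the norm of vectors with vanishing urn sums,
  \<open>v z = (\<Sum>t<m. p ((R ^^ t) z))\<close> is a norm in which already \<open>R\<close> is a strict contraction:
  passing from \<open>z\<close> to \<open>R z\<close> trades the term \<open>p z\<close> for \<open>p ((R ^^ m) z)\<close>.\<close>

theorem averaging_recursion_converges:
  assumes reg: regular
    and rec: "\<And>n j k. n > 0 \<Longrightarrow> j \<in> S \<Longrightarrow> k < K \<Longrightarrow>
      A (Suc n) j k = A n j k + (Q (A n) j k - A n j k + e n j k) / (real n + 1)"
    and A_sum: "\<And>n j. n > 0 \<Longrightarrow> j \<in> S \<Longrightarrow> (\<Sum>k<K. A n j k) = 1"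
    and e: "\<And>j k. j \<in> S \<Longrightarrow> k < K \<Longrightarrow> (\<lambda>n. e n j k) \<longlonglongrightarrow> 0"
    and V: "\<And>j k. j \<in> S \<Longrightarrow> k < K \<Longrightarrow> Q V j k = V j k"
    and V_sum: "\<And>j. j \<in> S \<Longrightarrow> (\<Sum>k<K. V j k) = 1"
    and j: "j \<in> S" and k: "k < K"
  shows "(\<lambda>n. A n j k) \<longlonglongrightarrow> V j k"
proof -
  obtain m where m: "m > 0"
    and half: "\<And>z. (\<And>j. j \<in> S \<Longrightarrow> (\<Sum>k<K. z j k) = 0) \<Longrightarrow> p ((R ^^ m) z) \<le> p z / 2"
    using R_pow_contracts[OF reg] by metis
  define v where "v z = (\<Sum>t<m. p ((R ^^ t) z))" for z
  have v_nonneg: "v z \<ge> 0" for z unfolding v_def by (intro sum_nonneg p_nonneg)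
  have p_le_v: "p z \<le> v z" for z
    unfolding v_def using member_le_sum[of 0 "{..<m}" "\<lambda>t. p ((R ^^ t) z)"] m p_nonneg by auto
  have v_le_p: "v z \<le> m * p z" for z
    unfolding v_def using sum_mono[of "{..<m}" "\<lambda>t. p ((R ^^ t) z)" "\<lambda>_. p z"] p_R_pow by simp
  have v_comb: "v (\<lambda>j k. a * x j k + b * y j k) \<le> \<bar>a\<bar> * v x + \<bar>b\<bar> * v y" for a b x y
    unfolding v_def R_pow_comb sum_distrib_left sum.distrib[symmetric] by (intro sum_mono p_comb)
  have v_cong: "v x = v y" if "\<And>j k. j \<in> S \<Longrightarrow> k < K \<Longrightarrow> x j k = y j k" for x y
    unfolding v_def using that by (intro sum.cong p_cong R_pow_cong) auto
  \<comment> \<open>The loss is at least \<open>p z / 2\<close>, and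
    \<open>v z \<le> m * p z\<close> makes this the fraction \<open>1 / (2 * m)\<close> of
    \<open>v z\<close>.\<close>
  have v_R: "v (R z) \<le> (1 - 1 / (2 * m)) * v z" if "\<And>j. j \<in> S \<Longrightarrow> (\<Sum>k<K. z j k) = 0" for z
  proof -
    have "v (R z) + p z = (\<Sum>t<Suc m. p ((R ^^ t) z))"
      unfolding v_def by (subst sum.lessThan_Suc_shift) (simp add: funpow_swap1)
    also have "\<dots> = v z + p ((R ^^ m) z)" unfolding v_def by simp
    finally have "v (R z) \<le> v z - p z / 2" using half[of z] that by simp
    moreover have "v z / (2 * m) \<le> p z / 2" using v_le_p[of z] m by (simp add: field_simps)
    ultimately show ?thesis by (simp add: algebra_simps)
  qed
  define d where "d n j k = A n j k - V j k" for n j k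
  have d_sum: "(\<Sum>k<K. d n j k) = 0" if "n > 0" "j \<in> S" for n j
    using that A_sum V_sum by (simp add: d_def sum_subtractf)
  have d_step: "v (d (Suc n)) \<le> (1 - (1 / m) / (real n + 1)) * v (d n) + v (e n) / (real n + 1)"
    if n: "n \<ge> 1" for n
  proof -
    define s where "s = 1 / (real n + 1)"
    \<comment> \<open>This is where \<open>n \<ge> 1\<close> matters: with
      \<open>s \<le> 1 / 2\<close>, the step without \<open>e n\<close> is a convex combination of
      \<open>d n\<close> and \<open>R (d n)\<close>, of weights \<open>1 - 2 * s\<close> and
      \<open>2 * s\<close>. The resulting rate is \<open>2 * s / (2 * m) = s / m\<close>.\<close>
    have s: "0 \<le> s" "s \<le> 1 / 2" using n by (auto simp: s_def field_simps)
    have Qd: "Q (d n) j k = Q (A n) j k - V j k" if "j \<in> S" "k < K" for j k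
      using Q_comb[of 1 "A n" "-1" V] V[OF that] by (simp add: d_def[abs_def])
    have vR: "v (R (d n)) \<le> (1 - 1 / (2 * m)) * v (d n)" using v_R d_sum n by auto
    have "v (d (Suc n))
        = v (\<lambda>j k. 1 * ((1 - 2 * s) * d n j k + (2 * s) * R (d n) j k) + s * e n j k)"
    proof (rule v_cong)
      fix j k assume jk: "j \<in> S" "k < K"
      have "d (Suc n) j k = A n j k + s * (Q (A n) j k - A n j k + e n j k) - V j k"
        using rec[of n, OF _ jk] n by (simp add: d_def s_def)
      also have "\<dots> = d n j k + s * (Q (d n) j k - d n j k) + s * e n j k"
        unfolding Qd[OF jk] by (simp add: d_def algebra_simps)
      also have "\<dots> = 1 * ((1 - 2 * s) * d n j k + (2 * s) * R (d n) j k) + s * e n j k"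
        by (simp add: R_def algebra_simps)
      finally show "d (Suc n) j k
          = 1 * ((1 - 2 * s) * d n j k + (2 * s) * R (d n) j k) + s * e n j k" .
    qed
    also have "\<dots> \<le> \<bar>1\<bar> * v (\<lambda>j k. (1 - 2 * s) * d n j k + (2 * s) * R (d n) j k) + \<bar>s\<bar> * v (e n)"
      by (rule v_comb)
    also have "\<dots> \<le> (\<bar>1 - 2 * s\<bar> * v (d n) + \<bar>2 * s\<bar> * v (R (d n))) + s * v (e n)"
      using v_comb[of "1 - 2 * s" "d n" "2 * s" "R (d n)"] s by simp
    also have "\<dots> \<le> ((1 - 2 * s) * v (d n) + 2 * s * ((1 - 1 / (2 * m)) * v (d n))) + s * v (e n)"
      using s vR by (intro add_mono) (auto intro: mult_left_mono)
    also have "\<dots> = (1 - (1 / m) * s) * v (d n) + s * v (e n)" by (simp add: algebra_simps)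
    finally show ?thesis by (simp add: s_def)
  qed
  have "(\<lambda>n. v (e n)) \<longlonglongrightarrow> 0"
  proof (rule tendsto_sandwich[OF _ _ tendsto_const])
    have "(\<lambda>n. real m * (\<Sum>j\<in>S. \<Sum>k<K. \<bar>e n j k\<bar>)) \<longlonglongrightarrow> real m * (\<Sum>j\<in>S. \<Sum>k<K. \<bar>0\<bar>)"
      using e by (intro tendsto_intros) auto
    thus "(\<lambda>n. real m * (\<Sum>j\<in>S. \<Sum>k<K. \<bar>e n j k\<bar>)) \<longlonglongrightarrow> 0" by simp
    show "\<forall>\<^sub>F n in sequentially. v (e n) \<le> real m * (\<Sum>j\<in>S. \<Sum>k<K. \<bar>e n j k\<bar>)"
      using order.trans[OF v_le_p mult_left_mono[OF p_le_sum]] by simp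
  qed (simp add: v_nonneg)
  hence v_lim: "(\<lambda>n. v (d n)) \<longlonglongrightarrow> 0"
    by (rule harmonic_contraction_tendsto_0[where c = "1 / m" and ?m0.0 = 1, rotated 2])
      (use m d_step v_nonneg in auto)
  have "\<bar>d n j k\<bar> \<le> v (d n)" for n
    using order.trans[OF abs_le_p[OF j k] p_le_v] .
  hence "(\<lambda>n. d n j k) \<longlonglongrightarrow> 0"
    by (intro Lim_null_comparison[OF _ v_lim]) simp
  thus ?thesis unfolding d_def by (simp add: LIM_zero_iff)
qed

end

section \<open>A strong law for orthogonal random variables\<close>

context prob_space
begin

text \<open>By monotone convergence the sum of the \<open>f k\<close> has finite expectation, so it
  is finite almost surely and its terms tend to 0.\<close>

lemma AE_tendsto_0_if_summable_integral:
  fixes f :: "nat \<Rightarrow> 'a \<Rightarrow> real"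
  assumes int: "\<And>k. integrable M (f k)" and nonneg: "\<And>k \<omega>. f k \<omega> \<ge> 0"
    and le: "\<And>k. integral\<^sup>L M (f k) \<le> c k" and c: "summable c"
  shows "AE \<omega> in M. (\<lambda>k. f k \<omega>) \<longlonglongrightarrow> 0"
proof -
  have meas[measurable]: "f k \<in> borel_measurable M" for k using int by (rule borel_measurable_integrable)
  have c0: "c k \<ge> 0" for k
    using le[of k] Bochner_Integration.integral_nonneg[of M "f k"] nonneg by (meson order_trans)
  have "(\<integral>\<^sup>+\<omega>. (\<Sum>k. ennreal (f k \<omega>)) \<partial>M) = (\<Sum>k. \<integral>\<^sup>+\<omega>. ennreal (f k \<omega>) \<partial>M)"
    by (rule nn_integral_suminf) simp
  also have "\<dots> \<le> (\<Sum>k. ennreal (c k))"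
    using le int nonneg by (intro suminf_le) (auto simp: nn_integral_eq_integral intro: ennreal_leI)
  also have "\<dots> = ennreal (\<Sum>k. c k)" using c c0 by (intro suminf_ennreal2)
  finally have "(\<integral>\<^sup>+\<omega>. (\<Sum>k. ennreal (f k \<omega>)) \<partial>M) \<noteq> \<infinity>" by (auto simp: top_unique)
  hence "AE \<omega> in M. (\<Sum>k. ennreal (f k \<omega>)) \<noteq> \<infinity>"
    by (intro nn_integral_PInf_AE) auto
  thus ?thesis
  proof eventually_elim
    case (elim \<omega>)
    hence "summable (\<lambda>k. f k \<omega>)" using nonneg by (intro summable_suminf_not_top) auto
    thus ?case by (rule summable_LIMSEQ_zero)
  qed
qed

lemma integrable_mult_square_integrable:
  fixes f g :: "'a \<Rightarrow> real"
  assumes [measurable]: "f \<in> borel_measurable M" "g \<in> borel_measurable M"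
    and "integrable M (\<lambda>\<omega>. (f \<omega>)\<^sup>2)" "integrable M (\<lambda>\<omega>. (g \<omega>)\<^sup>2)"
  shows "integrable M (\<lambda>\<omega>. f \<omega> * g \<omega>)"
proof (rule Bochner_Integration.integrable_bound)
  show "integrable M (\<lambda>\<omega>. (f \<omega>)\<^sup>2 + (g \<omega>)\<^sup>2)" using assms by simp
  have "\<bar>a * b\<bar> \<le> a\<^sup>2 + b\<^sup>2" for a b :: real
  proof -
    have "2 * (\<bar>a\<bar> * \<bar>b\<bar>) \<le> a\<^sup>2 + b\<^sup>2"
      using zero_le_power2[of "\<bar>a\<bar> - \<bar>b\<bar>"] by (simp add: power2_diff)
    moreover have "0 \<le> \<bar>a\<bar> * \<bar>b\<bar>" by simp
    ultimately show ?thesis unfolding abs_mult by linarith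
  qed
  thus "AE \<omega> in M. norm (f \<omega> * g \<omega>) \<le> norm ((f \<omega>)\<^sup>2 + (g \<omega>)\<^sup>2)" by simp
qed measurable

text \<open>Along the squares, Chebyshev's bound for \<open>S n / n\<close> is summable. The gap between \<open>k\<^sup>2\<close> and
  \<open>(k + 1)\<^sup>2\<close> is short enough that the sum of the second moments of all the \<open>S n - S (k\<^sup>2)\<close> in it
  controls their maximum, so that no maximal inequality is needed.\<close>

theorem strong_law_orthogonal:
  fixes \<xi> :: "nat \<Rightarrow> 'a \<Rightarrow> real"
  assumes meas[measurable]: "\<And>n. \<xi> n \<in> borel_measurable M"
    and sq_int: "\<And>n. integrable M (\<lambda>\<omega>. (\<xi> n \<omega>)\<^sup>2)"
    and sq_le: "\<And>n. (\<integral>\<omega>. (\<xi> n \<omega>)\<^sup>2 \<partial>M) \<le> C"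
    and orth: "\<And>m n. m < n \<Longrightarrow> (\<integral>\<omega>. \<xi> m \<omega> * \<xi> n \<omega> \<partial>M) = 0"
  shows "AE \<omega> in M. (\<lambda>n. (\<Sum>i<n. \<xi> i \<omega>) / n) \<longlonglongrightarrow> 0"
proof -
  have C: "C \<ge> 0" by (rule order.trans[OF Bochner_Integration.integral_nonneg sq_le[of 0]]) simp
  have prod_int: "integrable M (\<lambda>\<omega>. \<xi> m \<omega> * \<xi> n \<omega>)" for m n
    by (rule integrable_mult_square_integrable[OF meas meas sq_int sq_int])
  have expand: "(\<Sum>i\<in>A. \<xi> i \<omega>)\<^sup>2 = (\<Sum>i\<in>A. \<Sum>j\<in>A. \<xi> i \<omega> * \<xi> j \<omega>)" for A :: "nat set" and \<omega>
    by (simp add: power2_eq_square sum_product)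
  have block_int: "integrable M (\<lambda>\<omega>. (\<Sum>i\<in>A. \<xi> i \<omega>)\<^sup>2)" for A :: "nat set"
    unfolding expand by (intro Bochner_Integration.integrable_sum prod_int)
  have block_le: "(\<integral>\<omega>. (\<Sum>i\<in>A. \<xi> i \<omega>)\<^sup>2 \<partial>M) \<le> C * card A" if fin: "finite A" for A :: "nat set"
  proof -
    have "(\<integral>\<omega>. (\<Sum>i\<in>A. \<xi> i \<omega>)\<^sup>2 \<partial>M) = (\<Sum>i\<in>A. \<Sum>j\<in>A. \<integral>\<omega>. \<xi> i \<omega> * \<xi> j \<omega> \<partial>M)"
      unfolding expand using prod_int
      by (subst Bochner_Integration.integral_sum)
        (auto intro!: sum.cong Bochner_Integration.integral_sum)
    also have "\<dots> = (\<Sum>i\<in>A. \<Sum>j\<in>A. if i = j then \<integral>\<omega>. (\<xi> i \<omega>)\<^sup>2 \<partial>M else 0)"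
    proof (intro sum.cong refl)
      fix i j
      show "(\<integral>\<omega>. \<xi> i \<omega> * \<xi> j \<omega> \<partial>M) = (if i = j then \<integral>\<omega>. (\<xi> i \<omega>)\<^sup>2 \<partial>M else 0)"
        using orth[of i j] orth[of j i]
        by (cases i j rule: linorder_cases) (auto simp: power2_eq_square mult.commute)
    qed
    also have "\<dots> = (\<Sum>i\<in>A. \<integral>\<omega>. (\<xi> i \<omega>)\<^sup>2 \<partial>M)" using fin by simp
    also have "\<dots> \<le> (\<Sum>i\<in>A. C)" using sq_le by (rule sum_mono)
    finally show ?thesis by (simp add: mult.commute)
  qed
  \<comment> \<open>Twice \<open>f k\<close> dominates the square of \<open>S n / n\<close> for all
    positive \<open>n\<close> with \<open>k\<^sup>2 \<le> n < (k + 1)\<^sup>2\<close>. Dividing by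
    \<open>k ^ 4\<close> replaces \<open>n\<^sup>2\<close> by its smallest possible value.\<close>
  define f where "f k \<omega> = ((\<Sum>i<k\<^sup>2. \<xi> i \<omega>)\<^sup>2
      + (\<Sum>n\<in>{k\<^sup>2..<(Suc k)\<^sup>2}. (\<Sum>i\<in>{k\<^sup>2..<n}. \<xi> i \<omega>)\<^sup>2)) / k ^ 4" for k \<omega>
  have f_nonneg: "f k \<omega> \<ge> 0" for k \<omega> unfolding f_def by (simp add: sum_nonneg)
  have f_int: "integrable M (f k)" for k
    unfolding f_def by (intro integrable_divide Bochner_Integration.integrable_add
        Bochner_Integration.integrable_sum block_int)
  \<comment> \<open>There are \<open>2 * k + 1 \<le> 3 * k\<close> gap terms, each at most
    \<open>3 * k * C\<close>; with the term of \<open>S (k\<^sup>2)\<close> this gives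
    \<open>1 + 3 * 3 = 10\<close>. For \<open>k = 0\<close> both sides are 0, as division by zero
    yields 0.\<close>
  have f_le: "integral\<^sup>L M (f k) \<le> 10 * C * inverse (real k ^ 2)" for k
  proof (cases "k = 0")
    case False
    have "integral\<^sup>L M (f k) = ((\<integral>\<omega>. (\<Sum>i<k\<^sup>2. \<xi> i \<omega>)\<^sup>2 \<partial>M)
        + (\<Sum>n\<in>{k\<^sup>2..<(Suc k)\<^sup>2}. \<integral>\<omega>. (\<Sum>i\<in>{k\<^sup>2..<n}. \<xi> i \<omega>)\<^sup>2 \<partial>M)) / k ^ 4"
      unfolding f_def
      by (simp add: Bochner_Integration.integral_add Bochner_Integration.integral_sum block_int)
    also have "\<dots> \<le> (C * k\<^sup>2 + (\<Sum>n\<in>{k\<^sup>2..<(Suc k)\<^sup>2}. C * (3 * k))) / k ^ 4"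
    proof (intro divide_right_mono add_mono sum_mono)
      show "(\<integral>\<omega>. (\<Sum>i<k\<^sup>2. \<xi> i \<omega>)\<^sup>2 \<partial>M) \<le> C * real (k\<^sup>2)" using block_le[of "{..<k\<^sup>2}"] by simp
      fix n assume "n \<in> {k\<^sup>2..<(Suc k)\<^sup>2}"
      hence "n - k\<^sup>2 \<le> 3 * k" using False by (auto simp: power2_eq_square)
      hence "C * real (n - k\<^sup>2) \<le> C * real (3 * k)" using C by (intro mult_left_mono) linarith+
      thus "(\<integral>\<omega>. (\<Sum>i\<in>{k\<^sup>2..<n}. \<xi> i \<omega>)\<^sup>2 \<partial>M) \<le> C * real (3 * k)"
        using block_le[of "{k\<^sup>2..<n}"] by simp
    qed simp
    also have "\<dots> \<le> (C * k\<^sup>2 + 3 * k * (C * (3 * k))) / k ^ 4"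
    proof -
      have "(Suc k)\<^sup>2 - k\<^sup>2 \<le> 3 * k" using False by (simp add: power2_eq_square)
      hence "real ((Suc k)\<^sup>2 - k\<^sup>2) * (C * (3 * k)) \<le> real (3 * k) * (C * (3 * k))"
        using C by (intro mult_right_mono of_nat_mono) auto
      thus ?thesis by (intro divide_right_mono add_left_mono) auto
    qed
    also have "\<dots> = 10 * C * inverse (real k ^ 2)"
      using False by (simp add: field_simps power2_eq_square power4_eq_xxxx)
    finally show ?thesis .
  qed (simp add: f_def[abs_def])
  have "summable (\<lambda>k. 10 * C * inverse (real k ^ 2))"
    by (intro summable_mult inverse_power_summable) auto
  from AE_tendsto_0_if_summable_integral[OF f_int f_nonneg f_le this] show ?thesis
  proof eventually_elim
    case (elim \<omega>)
    have "(\<lambda>n. ((\<Sum>i<n. \<xi> i \<omega>) / n)\<^sup>2) \<longlonglongrightarrow> 0"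
    proof (rule Lim_null_comparison)
      have "LIM n sequentially. floor_sqrt n :> sequentially"
        by (auto simp: filterlim_at_top le_floor_sqrt_iff intro: eventually_ge_at_top)
      thus "(\<lambda>n. 2 * f (floor_sqrt n) \<omega>) \<longlonglongrightarrow> 0"
        using filterlim_compose[OF elim] by (intro tendsto_mult_right_zero) auto
      have "norm (((\<Sum>i<n. \<xi> i \<omega>) / n)\<^sup>2) \<le> 2 * f (floor_sqrt n) \<omega>" if n: "n > 0" for n
      proof -
        \<comment> \<open>The block of \<open>n\<close>: \<open>a\<close> is the sum up to its left
          end, \<open>b\<close> the rest, and
          \<open>(a + b)\<^sup>2 \<le> 2 * (a\<^sup>2 + b\<^sup>2)\<close> explains the factor
          2.\<close>
        define k where "k = floor_sqrt n"
        have k: "k\<^sup>2 \<le> n" "n < (Suc k)\<^sup>2" "k > 0"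
          using n Suc_floor_sqrt_power2_gt[of n] by (auto simp: k_def)
        define a b where "a = (\<Sum>i<k\<^sup>2. \<xi> i \<omega>)" and "b = (\<Sum>i\<in>{k\<^sup>2..<n}. \<xi> i \<omega>)"
        have "(\<Sum>i<n. \<xi> i \<omega>) = a + b"
          unfolding a_def b_def using k(1) by (simp add: lessThan_atLeast0 sum.atLeastLessThan_concat)
        moreover have "(a + b)\<^sup>2 \<le> 2 * (a\<^sup>2 + b\<^sup>2)"
          using zero_le_power2[of "a - b"] by (simp add: power2_sum power2_diff)
        moreover have "b\<^sup>2 \<le> (\<Sum>n\<in>{k\<^sup>2..<(Suc k)\<^sup>2}. (\<Sum>i\<in>{k\<^sup>2..<n}. \<xi> i \<omega>)\<^sup>2)"
          unfolding b_def using k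
          by (intro member_le_sum[of n _ "\<lambda>n. (\<Sum>i\<in>{k\<^sup>2..<n}. \<xi> i \<omega>)\<^sup>2"]) auto
        ultimately have "(\<Sum>i<n. \<xi> i \<omega>)\<^sup>2 / k ^ 4 \<le> 2 * f k \<omega>"
          unfolding f_def using k by (simp add: a_def divide_right_mono)
        moreover have "(\<Sum>i<n. \<xi> i \<omega>)\<^sup>2 / (real n)\<^sup>2 \<le> (\<Sum>i<n. \<xi> i \<omega>)\<^sup>2 / k ^ 4"
        proof (rule divide_left_mono)
          have "real (k\<^sup>2) \<le> real n" using k(1) by (rule of_nat_mono)
          hence "(real (k\<^sup>2))\<^sup>2 \<le> (real n)\<^sup>2" by (intro power_mono) auto
          thus "real (k ^ 4) \<le> (real n)\<^sup>2" by simp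
        qed (use n k in auto)
        ultimately show ?thesis by (simp add: power_divide k_def)
      qed
      thus "\<forall>\<^sub>F n in sequentially. norm (((\<Sum>i<n. \<xi> i \<omega>) / n)\<^sup>2) \<le> 2 * f (floor_sqrt n) \<omega>"
        by (intro eventually_mono[OF eventually_gt_at_top[of 0]])
    qed
    from tendsto_real_sqrt[OF this] have "(\<lambda>n. \<bar>(\<Sum>i<n. \<xi> i \<omega>) / n\<bar>) \<longlonglongrightarrow> 0" by simp
    thus ?case by (rule tendsto_rabs_zero_cancel)
  qed
qed

end

section \<open>Interacting urns\<close>

lemma space_generated_algebra [simp]: "space (generated_algebra M G) = space M"
  by (simp add: generated_algebra_def space_measure_of_conv)

lemma sets_generated_algebra:
  "sets (generated_algebra M G)
    = sigma_sets (space M) {f -` B \<inter> space M |f B. f \<in> G \<and> B \<in> sets borel}"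
  unfolding generated_algebra_def by (rule sets_measure_of) auto

lemma measurable_generated_algebra: "f \<in> G \<Longrightarrow> f \<in> borel_measurable (generated_algebra M G)"
  by (rule measurableI) (auto simp: sets_generated_algebra)

lemma subalgebra_generated_algebra:
  assumes "\<And>f. f \<in> G \<Longrightarrow> f \<in> borel_measurable M"
  shows "subalgebra M (generated_algebra M G)"
  unfolding subalgebra_def sets_generated_algebra
  using assms by (auto intro!: sets.sigma_sets_subset measurable_sets)

lemma subalgebra_generated_algebra_mono:
  assumes "G \<subseteq> G'"
  shows "subalgebra (generated_algebra M G') (generated_algebra M G)"
  unfolding subalgebra_def sets_generated_algebra
  using assms by (auto intro!: sigma_sets_subseteq)

lemma (in prob_space) indep_var_subalgebras:
  fixes f g :: "'a \<Rightarrow> real"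
  assumes indep: "indep_set (sets A) (sets B)"
    and space: "space A = space M" "space B = space M"
    and f: "f \<in> borel_measurable A" and g: "g \<in> borel_measurable B"
  shows "indep_var borel f borel g"
proof -
  have A: "sets A \<subseteq> events" and B: "sets B \<subseteq> events"
    using indep by (auto simp: indep_sets2_eq)
  have fM: "f \<in> borel_measurable M" and gM: "g \<in> borel_measurable M"
    using A B space f g by (auto intro: measurable_from_subalg simp: subalgebra_def)
  have "sigma_sets (space M) {f -` S \<inter> space M |S. S \<in> sets borel} \<subseteq> sets A"
    using measurable_sets[OF f] unfolding space(1)[symmetric] by (intro sets.sigma_sets_subset) auto
  moreover have "sigma_sets (space M) {g -` S \<inter> space M |S. S \<in> sets borel} \<subseteq> sets B"
    using measurable_sets[OF g] unfolding space(2)[symmetric] by (intro sets.sigma_sets_subset) auto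
  ultimately show ?thesis
    using indep fM gM unfolding indep_var_eq indep_sets2_eq by blast
qed

context interacting_urns
begin

section \<open>Measurability, and expectations weighted by functions of the past\<close>

text \<open>Measurability is part of \<open>indep_vars\<close>, so \<open>D_indep\<close> supplies
  it.\<close>

lemma replacement_matrix_measurable:
  assumes "j < N" "n \<ge> 1"
  shows "replacement_matrix K D j n \<in> M \<rightarrow>\<^sub>M matrix_space K"
  using D_indep[OF assms(1)] assms(2) unfolding indep_vars_def by auto

lemma replacement_matrix_component:
  "k < K \<Longrightarrow> i < K \<Longrightarrow> (\<lambda>\<omega>. replacement_matrix K D j n \<omega> (k, i)) = D j n k i"
  by (auto simp: replacement_matrix_def)

lemma D_measurable:
  assumes "j < N" "n \<ge> 1" "k < K" "i < K"
  shows "D j n k i \<in> borel_measurable M"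
proof -
  have "(\<lambda>\<omega>. replacement_matrix K D j n \<omega> (k, i)) \<in> borel_measurable M"
    using assms by (intro measurable_compose[OF replacement_matrix_measurable measurable_component_singleton]) auto
  thus ?thesis by (simp only: replacement_matrix_component[OF assms(3,4)])
qed

lemma D_measurable_vimage:
  assumes "j < N" "k < K" "i < K"
  shows "D j (Suc n) k i \<in> borel_measurable
    (vimage_algebra (space M) (replacement_matrix K D j (Suc n)) (matrix_space K))"
proof -
  have "replacement_matrix K D j (Suc n) \<in> space M \<rightarrow> space (matrix_space K)"
    using replacement_matrix_measurable[OF assms(1), of "Suc n"] by (auto dest: measurable_space)
  hence "(\<lambda>\<omega>. replacement_matrix K D j (Suc n) \<omega> (k, i)) \<in> borel_measurable
    (vimage_algebra (space M) (replacement_matrix K D j (Suc n)) (matrix_space K))"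
    using assms
    by (intro measurable_compose[OF measurable_vimage_algebra1 measurable_component_singleton]) auto
  thus ?thesis by (simp only: replacement_matrix_component[OF assms(2,3)])
qed

lemma expectation_D_time:
  assumes "j < N" "n \<ge> 1" "k < K" "i < K"
  shows "(\<integral>\<omega>. D j n k i \<omega> \<partial>M) = (\<integral>\<omega>. D j 1 k i \<omega> \<partial>M)"
proof -
  have "(\<integral>\<omega>. D j n k i \<omega> \<partial>M)
      = (\<integral>A. A (k, i) \<partial>distr M (matrix_space K) (replacement_matrix K D j n))" if "n \<ge> 1" for n
    using assms that
    by (subst integral_distr[OF replacement_matrix_measurable])
      (auto simp: replacement_matrix_def intro!: Bochner_Integration.integral_cong)
  from this[of n] this[of 1] show ?thesis using D_ident[OF assms(1,2), of 1] assms(2) by simp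
qed

lemma Y_measurable:
  assumes "j < N" "k < K"
  shows "Y j k n \<in> borel_measurable M"
proof (induction n)
  case 0
  have "(\<lambda>\<omega>. y0 j k) \<in> borel_measurable M" by simp
  thus ?case by (rule measurable_cong[THEN iffD1, rotated]) (simp add: Y_init[OF assms])
next
  case (Suc n)
  have "(\<lambda>\<omega>. Y j k n \<omega> + (\<Sum>i<K. D j (Suc n) k i \<omega> * X j i (Suc n) \<omega>)) \<in> borel_measurable M"
    using assms Suc by (intro borel_measurable_add borel_measurable_sum borel_measurable_times
        D_measurable X_measurable) auto
  thus ?case by (rule measurable_cong[THEN iffD1, rotated]) (simp add: Y_step[OF assms])
qed

lemma history_vars_measurable: "f \<in> history_vars N K X Y n \<Longrightarrow> f \<in> borel_measurable M"
  unfolding history_vars_def using X_measurable Y_measurable by auto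

abbreviation F :: "nat \<Rightarrow> 'a measure" where
  "F n \<equiv> history M N K X Y n"

lemma subalgebra_history: "subalgebra M (F n)"
  unfolding history_def by (intro subalgebra_generated_algebra history_vars_measurable)

lemma subalgebra_history_mono: "m \<le> n \<Longrightarrow> subalgebra (F n) (F m)"
  unfolding history_def history_vars_def by (intro subalgebra_generated_algebra_mono) fastforce

lemma sigma_finite_history: "sigma_finite_subalgebra M (F n)"
  by (intro finite_measure_subalgebra_is_sigma_finite finite_measure_subalgebra.intro
      finite_measure_subalgebra_axioms.intro subalgebra_history finite_measure_axioms)

lemma Y_history: "j < N \<Longrightarrow> k < K \<Longrightarrow> m \<le> n \<Longrightarrow> Y j k m \<in> borel_measurable (F n)"
  unfolding history_def by (rule measurable_generated_algebra) (auto simp: history_vars_def)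

lemma sampling_prob_history:
  "i < K \<Longrightarrow> sampling_prob N K W Y j i n \<in> borel_measurable (F n)"
  unfolding sampling_prob_def[abs_def] proportion_def total_def
  by (intro borel_measurable_sum borel_measurable_times borel_measurable_const
      borel_measurable_divide Y_history) auto

lemma X_le_1: "j < N \<Longrightarrow> i < K \<Longrightarrow> n \<ge> 1 \<Longrightarrow> \<omega> \<in> space M \<Longrightarrow> 0 \<le> X j i n \<omega> \<and> X j i n \<omega> \<le> 1"
  using X_indicator[of j i n \<omega>] by auto

lemma Y_pos: "j < N \<Longrightarrow> k < K \<Longrightarrow> \<omega> \<in> space M \<Longrightarrow> Y j k n \<omega> > 0"
proof (induction n)
  case (Suc n)
  have "(\<Sum>i<K. D j (Suc n) k i \<omega> * X j i (Suc n) \<omega>) \<ge> 0"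
    using Suc.prems D_nonneg X_le_1 by (intro sum_nonneg mult_nonneg_nonneg) auto
  thus ?case using Suc by (simp add: Y_step)
qed (simp add: Y_init y0_pos)

lemma total_pos: "j < N \<Longrightarrow> \<omega> \<in> space M \<Longrightarrow> total K Y j n \<omega> > 0"
  unfolding total_def using K_pos by (intro sum_pos Y_pos) (auto simp: lessThan_empty_iff)

lemma proportion_nonneg: "j < N \<Longrightarrow> k < K \<Longrightarrow> \<omega> \<in> space M \<Longrightarrow> proportion K Y j k n \<omega> \<ge> 0"
  unfolding proportion_def by (intro divide_nonneg_nonneg less_imp_le[OF Y_pos] less_imp_le[OF total_pos])

lemma sum_proportion: "j < N \<Longrightarrow> \<omega> \<in> space M \<Longrightarrow> (\<Sum>k<K. proportion K Y j k n \<omega>) = 1"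
  using total_pos[of j \<omega> n] unfolding proportion_def sum_divide_distrib[symmetric]
  by (simp add: total_def[symmetric])

lemma sampling_prob_nonneg:
  "j < N \<Longrightarrow> i < K \<Longrightarrow> \<omega> \<in> space M \<Longrightarrow> sampling_prob N K W Y j i n \<omega> \<ge> 0"
  unfolding sampling_prob_def using W_bounds by (intro sum_nonneg mult_nonneg_nonneg proportion_nonneg) auto

lemma sum_sampling_prob:
  assumes "j < N" "\<omega> \<in> space M"
  shows "(\<Sum>i<K. sampling_prob N K W Y j i n \<omega>) = 1"
proof -
  have "(\<Sum>i<K. sampling_prob N K W Y j i n \<omega>)
      = (\<Sum>h<N. W $$ (j, h) * (\<Sum>i<K. proportion K Y h i n \<omega>))"
    unfolding sampling_prob_def by (subst sum.swap) (simp add: sum_distrib_left)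
  also have "\<dots> = 1" using W_row_sum[OF assms(1)] by (simp add: sum_proportion assms(2))
  finally show ?thesis .
qed

lemma sampling_prob_le_1:
  assumes "j < N" "i < K" "\<omega> \<in> space M"
  shows "sampling_prob N K W Y j i n \<omega> \<le> 1"
proof -
  have "sampling_prob N K W Y j i n \<omega> \<le> (\<Sum>i<K. sampling_prob N K W Y j i n \<omega>)"
    using assms sampling_prob_nonneg
    by (intro member_le_sum[of i _ "\<lambda>i. sampling_prob N K W Y j i n \<omega>"]) auto
  thus ?thesis using sum_sampling_prob[OF assms(1,3)] by simp
qed

lemma integrable_bounded_times:
  fixes f g :: "'a \<Rightarrow> real"
  assumes "f \<in> borel_measurable M" "\<And>\<omega>. \<omega> \<in> space M \<Longrightarrow> 0 \<le> f \<omega> \<and> f \<omega> \<le> 1" "integrable M g"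
  shows "integrable M (\<lambda>\<omega>. f \<omega> * g \<omega>)"
proof (rule Bochner_Integration.integrable_bound[OF assms(3)])
  show "AE \<omega> in M. norm (f \<omega> * g \<omega>) \<le> norm (g \<omega>)"
    using assms(2) by (auto simp: abs_mult intro!: AE_I2 mult_left_le_one_le)
qed (use assms in measurable)

text \<open>Against a weight known at time \<open>n\<close>, the sampled color may be replaced by
  its conditional expectation. The weight need not be bounded, because both factors lie between 0
  and 1.\<close>

lemma X_times_history:
  assumes jk: "j < N" "i < K" and g: "g \<in> borel_measurable (F n)" "integrable M g"
  shows "integrable M (\<lambda>\<omega>. X j i (Suc n) \<omega> * g \<omega>)"
    and "integrable M (\<lambda>\<omega>. sampling_prob N K W Y j i n \<omega> * g \<omega>)"
    and "(\<integral>\<omega>. X j i (Suc n) \<omega> * g \<omega> \<partial>M) = (\<integral>\<omega>. sampling_prob N K W Y j i n \<omega> * g \<omega> \<partial>M)"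
proof -
  interpret sub: sigma_finite_subalgebra M "F n" by (rule sigma_finite_history)
  have Xm: "X j i (Suc n) \<in> borel_measurable M" using jk by (intro X_measurable) auto
  have sm: "sampling_prob N K W Y j i n \<in> borel_measurable M"
    using sampling_prob_history[OF jk(2)] by (rule measurable_from_subalg[OF subalgebra_history])
  show int: "integrable M (\<lambda>\<omega>. X j i (Suc n) \<omega> * g \<omega>)"
    using Xm X_le_1 jk g by (intro integrable_bounded_times) auto
  show "integrable M (\<lambda>\<omega>. sampling_prob N K W Y j i n \<omega> * g \<omega>)"
    using sm sampling_prob_nonneg sampling_prob_le_1 jk g by (intro integrable_bounded_times) auto
  have "(\<integral>\<omega>. X j i (Suc n) \<omega> * g \<omega> \<partial>M) = (\<integral>\<omega>. g \<omega> * real_cond_exp M (F n) (X j i (Suc n)) \<omega> \<partial>M)"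
    using int g Xm by (subst sub.real_cond_exp_intg(2)) (auto simp: mult.commute)
  also have "\<dots> = (\<integral>\<omega>. g \<omega> * sampling_prob N K W Y j i n \<omega> \<partial>M)"
  proof (rule integral_cong_AE)
    show "AE \<omega> in M. g \<omega> * real_cond_exp M (F n) (X j i (Suc n)) \<omega>
        = g \<omega> * sampling_prob N K W Y j i n \<omega>"
      using X_cond_exp[OF jk, of n] by eventually_elim simp
  qed (use g sm in \<open>auto intro!: borel_measurable_times\<close>)
  finally show "(\<integral>\<omega>. X j i (Suc n) \<omega> * g \<omega> \<partial>M) = (\<integral>\<omega>. sampling_prob N K W Y j i n \<omega> * g \<omega> \<partial>M)"
    by (simp add: mult.commute)
qed

text \<open>The new matrix is independent of the product of the sampled color and the weight, as
  both are measurable with respect to the algebra in \<open>D_indep_rest\<close>; so the expectation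
  factors before the color is averaged.\<close>

lemma D_times_X_history:
  assumes j: "j < N" "k < K" "i < K" and D: "integrable M (D j (Suc n) k i)"
    and g: "g \<in> borel_measurable (F n)" "integrable M g"
  shows "integrable M (\<lambda>\<omega>. D j (Suc n) k i \<omega> * (X j i (Suc n) \<omega> * g \<omega>))"
    and "(\<integral>\<omega>. D j (Suc n) k i \<omega> * (X j i (Suc n) \<omega> * g \<omega>) \<partial>M)
      = (\<integral>\<omega>. D j 1 k i \<omega> \<partial>M) * (\<integral>\<omega>. sampling_prob N K W Y j i n \<omega> * g \<omega> \<partial>M)"
proof -
  define G where "G = history_vars N K X Y n \<union> {X h i (Suc n) |h i. h < N \<and> i < K} \<union>
    {D h m k i |h m k i. h < N \<and> h \<noteq> j \<and> m \<ge> 1 \<and> k < K \<and> i < K}"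
  have "X j i (Suc n) \<in> borel_measurable (generated_algebra M G)"
    using j by (intro measurable_generated_algebra) (auto simp: G_def)
  moreover have "g \<in> borel_measurable (generated_algebra M G)"
    using g(1) unfolding history_def
    by (rule measurable_from_subalg[rotated])
      (auto simp: G_def intro: subalgebra_generated_algebra_mono)
  ultimately have Xg: "(\<lambda>\<omega>. X j i (Suc n) \<omega> * g \<omega>) \<in> borel_measurable (generated_algebra M G)"
    by simp
  have ind: "indep_var borel (D j (Suc n) k i) borel (\<lambda>\<omega>. X j i (Suc n) \<omega> * g \<omega>)"
    by (rule indep_var_subalgebras[OF D_indep_rest[OF j(1), of n, folded G_def] _ _
          D_measurable_vimage[OF j] Xg]) simp_all
  have int: "integrable M (\<lambda>\<omega>. X j i (Suc n) \<omega> * g \<omega>)" using X_times_history(1) j g by blast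
  show "integrable M (\<lambda>\<omega>. D j (Suc n) k i \<omega> * (X j i (Suc n) \<omega> * g \<omega>))"
    by (rule indep_var_integrable[OF ind D int])
  have "(\<integral>\<omega>. D j (Suc n) k i \<omega> * (X j i (Suc n) \<omega> * g \<omega>) \<partial>M)
      = (\<integral>\<omega>. D j (Suc n) k i \<omega> \<partial>M) * (\<integral>\<omega>. X j i (Suc n) \<omega> * g \<omega> \<partial>M)"
    by (rule indep_var_lebesgue_integral[OF ind D int])
  thus "(\<integral>\<omega>. D j (Suc n) k i \<omega> * (X j i (Suc n) \<omega> * g \<omega>) \<partial>M)
      = (\<integral>\<omega>. D j 1 k i \<omega> \<partial>M) * (\<integral>\<omega>. sampling_prob N K W Y j i n \<omega> * g \<omega> \<partial>M)"
    using expectation_D_time[of j "Suc n" k i] X_times_history(3)[OF j(1,3) g] j by simp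
qed

end

section \<open>Compositions as drift plus noise\<close>

locale balanced_urns = interacting_urns +
  fixes C :: real
  assumes D_sq_integrable: "\<And>j n k i. j < N \<Longrightarrow> n \<ge> 1 \<Longrightarrow> k < K \<Longrightarrow> i < K \<Longrightarrow>
      integrable M (\<lambda>\<omega>. (D j n k i \<omega>)\<^sup>2)"
    and D_sq_le: "\<And>j n k i. j < N \<Longrightarrow> n \<ge> 1 \<Longrightarrow> k < K \<Longrightarrow> i < K \<Longrightarrow>
      (\<integral>\<omega>. (D j n k i \<omega>)\<^sup>2 \<partial>M) \<le> C"
    and D_balanced: "\<And>j i. j < N \<Longrightarrow> i < K \<Longrightarrow> (\<Sum>k<K. \<integral>\<omega>. D j 1 k i \<omega> \<partial>M) = 1"
begin

definition H :: "nat \<Rightarrow> nat \<Rightarrow> nat \<Rightarrow> real" where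
  "H j k i = (\<integral>\<omega>. D j 1 k i \<omega> \<partial>M)"

lemma H_nonneg: "j < N \<Longrightarrow> k < K \<Longrightarrow> i < K \<Longrightarrow> H j k i \<ge> 0"
  unfolding H_def by (intro Bochner_Integration.integral_nonneg D_nonneg) auto

lemma sum_H: "j < N \<Longrightarrow> i < K \<Longrightarrow> (\<Sum>k<K. H j k i) = 1"
  unfolding H_def by (rule D_balanced)

lemma H_le_1:
  assumes "j < N" "k < K" "i < K"
  shows "H j k i \<le> 1"
  using member_le_sum[of k "{..<K}" "\<lambda>k. H j k i"] sum_H[of j i] H_nonneg assms by auto

lemma D_integrable:
  assumes "j < N" "n \<ge> 1" "k < K" "i < K"
  shows "integrable M (D j n k i)"
  using integrable_mult_square_integrable[OF D_measurable[OF assms] _ D_sq_integrable[OF assms], of "\<lambda>_. 1"]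
  by simp

text \<open>A martingale difference: the subtracted sum is the conditional mean of the increment
  given \<open>F n\<close>. It is known at time \<open>n + 1\<close>.\<close>

definition noise :: "nat \<Rightarrow> nat \<Rightarrow> nat \<Rightarrow> 'a \<Rightarrow> real" where
  "noise j k n \<omega> = Y j k (Suc n) \<omega> - Y j k n \<omega> - (\<Sum>i<K. H j k i * sampling_prob N K W Y j i n \<omega>)"

lemma noise_history:
  assumes jk: "j < N" "k < K" and n: "Suc n \<le> m"
  shows "noise j k n \<in> borel_measurable (F m)"
proof -
  have "sampling_prob N K W Y j i n \<in> borel_measurable (F m)" if "i < K" for i
    using sampling_prob_history[OF that] n
    by (intro measurable_from_subalg[OF subalgebra_history_mono[of n m]]) auto
  thus ?thesis
    unfolding noise_def[abs_def] using jk n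
    by (intro borel_measurable_diff borel_measurable_sum borel_measurable_times
        borel_measurable_const Y_history) auto
qed

lemma noise_measurable: "j < N \<Longrightarrow> k < K \<Longrightarrow> noise j k n \<in> borel_measurable M"
  by (rule measurable_from_subalg[OF subalgebra_history noise_history]) auto

text \<open>In each summand the part with \<open>D\<close> is at most \<open>D\<close>, since
  \<open>X\<close> is 0 or 1, and the mean part is at most 1. The rest is Cauchy-Schwarz and
  \<open>(x + 1)\<^sup>2 \<le> 2 * x\<^sup>2 + 2\<close>.\<close>

lemma noise_sq_le:
  assumes jk: "j < N" "k < K" and \<omega>: "\<omega> \<in> space M"
  shows "(noise j k n \<omega>)\<^sup>2 \<le> (\<Sum>i<K. (2 * (D j (Suc n) k i \<omega>)\<^sup>2 + 2)) * K"
proof -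
  have "\<bar>noise j k n \<omega>\<bar>
      = \<bar>\<Sum>i<K. D j (Suc n) k i \<omega> * X j i (Suc n) \<omega> - H j k i * sampling_prob N K W Y j i n \<omega>\<bar>"
    using \<omega> jk by (simp add: noise_def Y_step sum_subtractf)
  also have "\<dots> \<le> (\<Sum>i<K. D j (Suc n) k i \<omega> + 1)"
  proof (rule order.trans[OF sum_abs], rule sum_mono)
    fix i assume "i \<in> {..<K}"
    hence i: "i < K" by simp
    have 1: "0 \<le> D j (Suc n) k i \<omega>" using D_nonneg jk i \<omega> by auto
    have 2: "0 \<le> D j (Suc n) k i \<omega> * X j i (Suc n) \<omega>"
        "D j (Suc n) k i \<omega> * X j i (Suc n) \<omega> \<le> D j (Suc n) k i \<omega>"
      using 1 X_le_1[of j i "Suc n" \<omega>] jk i \<omega> by (auto intro: mult_left_le)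
    have 3: "0 \<le> H j k i * sampling_prob N K W Y j i n \<omega>"
        "H j k i * sampling_prob N K W Y j i n \<omega> \<le> 1"
      using H_nonneg[of j k i] H_le_1[of j k i] sampling_prob_nonneg[of j i \<omega> n]
        sampling_prob_le_1[of j i \<omega> n] jk i \<omega> by (auto intro: mult_le_one)
    show "\<bar>D j (Suc n) k i \<omega> * X j i (Suc n) \<omega> - H j k i * sampling_prob N K W Y j i n \<omega>\<bar>
        \<le> D j (Suc n) k i \<omega> + 1" using 1 2 3 by linarith
  qed
  finally have "(noise j k n \<omega>)\<^sup>2 \<le> (\<Sum>i<K. D j (Suc n) k i \<omega> + 1)\<^sup>2"
    using power_mono[of "\<bar>noise j k n \<omega>\<bar>" _ 2] by simp
  also have "\<dots> \<le> (\<Sum>i<K. (D j (Suc n) k i \<omega> + 1)\<^sup>2) * card {..<K}"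
    by (rule sum_squared_le_sum_of_squares)
  also have "\<dots> \<le> (\<Sum>i<K. 2 * (D j (Suc n) k i \<omega>)\<^sup>2 + 2) * K"
  proof -
    have "(x + 1)\<^sup>2 \<le> 2 * x\<^sup>2 + 2" for x :: real
      using zero_le_power2[of "x - 1"] by (simp add: power2_sum power2_diff)
    thus ?thesis by (simp add: mult_right_mono sum_mono)
  qed
  finally show ?thesis .
qed

lemma noise_sq_integrable:
  assumes jk: "j < N" "k < K"
  shows "integrable M (\<lambda>\<omega>. (noise j k n \<omega>)\<^sup>2)"
    and "(\<integral>\<omega>. (noise j k n \<omega>)\<^sup>2 \<partial>M) \<le> (2 * C + 2) * (real K)\<^sup>2"
proof -
  have bound_int: "integrable M (\<lambda>\<omega>. (\<Sum>i<K. (2 * (D j (Suc n) k i \<omega>)\<^sup>2 + 2)) * K)"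
    using jk D_sq_integrable by (intro integrable_mult_left Bochner_Integration.integrable_sum
        Bochner_Integration.integrable_add integrable_mult_right) auto
  show int: "integrable M (\<lambda>\<omega>. (noise j k n \<omega>)\<^sup>2)"
  proof (rule Bochner_Integration.integrable_bound[OF bound_int])
    show "AE \<omega> in M. norm ((noise j k n \<omega>)\<^sup>2) \<le> norm ((\<Sum>i<K. (2 * (D j (Suc n) k i \<omega>)\<^sup>2 + 2)) * K)"
      using noise_sq_le[OF jk] by (intro AE_I2) (simp add: abs_of_nonneg sum_nonneg)
  qed (use noise_measurable[OF jk] in measurable)
  have "(\<integral>\<omega>. (noise j k n \<omega>)\<^sup>2 \<partial>M) \<le> (\<integral>\<omega>. (\<Sum>i<K. (2 * (D j (Suc n) k i \<omega>)\<^sup>2 + 2)) * K \<partial>M)"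
    by (intro integral_mono int bound_int noise_sq_le jk)
  also have "\<dots> = (\<Sum>i<K. 2 * (\<integral>\<omega>. (D j (Suc n) k i \<omega>)\<^sup>2 \<partial>M) + 2) * K"
  proof -
    have "integrable M (\<lambda>\<omega>. 2 * (D j (Suc n) k i \<omega>)\<^sup>2 + 2)"
      and "(\<integral>\<omega>. 2 * (D j (Suc n) k i \<omega>)\<^sup>2 + 2 \<partial>M) = 2 * (\<integral>\<omega>. (D j (Suc n) k i \<omega>)\<^sup>2 \<partial>M) + 2"
      if "i < K" for i
      using D_sq_integrable[of j "Suc n" k i] jk that
      by (simp_all add: Bochner_Integration.integral_add prob_space)
    thus ?thesis by (simp add: Bochner_Integration.integral_sum)
  qed
  also have "\<dots> \<le> (\<Sum>i<K. 2 * C + 2) * K"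
    using D_sq_le jk by (intro mult_right_mono sum_mono) auto
  finally show "(\<integral>\<omega>. (noise j k n \<omega>)\<^sup>2 \<partial>M) \<le> (2 * C + 2) * (real K)\<^sup>2"
    by (simp add: power2_eq_square mult_ac)
qed

lemma noise_integrable: "j < N \<Longrightarrow> k < K \<Longrightarrow> integrable M (noise j k n)"
  using integrable_mult_square_integrable[OF noise_measurable _ noise_sq_integrable(1), of j k "\<lambda>_. 1"]
  by simp

text \<open>The earlier noise is known at time \<open>n\<close> and serves as the weight
  \<open>g\<close>; against it the sampled and the mean part of the later noise have equal
  expectations, color by color.\<close>

lemma noise_orthogonal:
  assumes jk: "j < N" "k < K" and mn: "m < n"
  shows "(\<integral>\<omega>. noise j k m \<omega> * noise j k n \<omega> \<partial>M) = 0"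
proof -
  define g where "g = noise j k m"
  have g: "g \<in> borel_measurable (F n)" "integrable M g"
    unfolding g_def using jk mn by (auto intro: noise_history noise_integrable)
  note DX = D_times_X_history[OF jk _ D_integrable g]
  note Xg = X_times_history[OF jk(1) _ g]
  have "(\<integral>\<omega>. noise j k m \<omega> * noise j k n \<omega> \<partial>M)
      = (\<integral>\<omega>. (\<Sum>i<K. D j (Suc n) k i \<omega> * (X j i (Suc n) \<omega> * g \<omega>)
          - H j k i * (sampling_prob N K W Y j i n \<omega> * g \<omega>)) \<partial>M)"
    using jk by (intro Bochner_Integration.integral_cong)
      (auto simp: noise_def[of j k n] Y_step g_def sum_subtractf sum_distrib_left algebra_simps)
  also have "\<dots> = (\<Sum>i<K. \<integral>\<omega>. (D j (Suc n) k i \<omega> * (X j i (Suc n) \<omega> * g \<omega>)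
          - H j k i * (sampling_prob N K W Y j i n \<omega> * g \<omega>)) \<partial>M)"
    using DX(1) Xg(2) jk by (intro Bochner_Integration.integral_sum) auto
  also have "\<dots> = (\<Sum>i<K. 0)"
  proof (rule sum.cong)
    fix i assume "i \<in> {..<K}"
    thus "(\<integral>\<omega>. (D j (Suc n) k i \<omega> * (X j i (Suc n) \<omega> * g \<omega>)
        - H j k i * (sampling_prob N K W Y j i n \<omega> * g \<omega>)) \<partial>M) = 0"
      using DX Xg(2) jk by (simp add: Bochner_Integration.integral_diff H_def)
  qed simp
  finally show ?thesis by simp
qed

text \<open>At \<open>n = 0\<close> the quotient is 0, so the urn sums are 1 only from
  \<open>n = 1\<close> on.\<close>

definition mean_proportion :: "nat \<Rightarrow> 'a \<Rightarrow> nat \<Rightarrow> nat \<Rightarrow> real" where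
  "mean_proportion n \<omega> j k = (\<Sum>m<n. proportion K Y j k m \<omega>) / n"

definition drift :: "nat \<Rightarrow> 'a \<Rightarrow> nat \<Rightarrow> nat \<Rightarrow> real" where
  "drift n \<omega> j k = (\<Sum>i<K. H j k i * (\<Sum>h<N. W $$ (j, h) * mean_proportion n \<omega> h i))"

text \<open>Sampling probabilities are linear in the proportions, so their sum over time is
  \<open>n\<close> times their value at the average.\<close>

lemma Y_eq_drift_noise:
  assumes jk: "j < N" "k < K" and \<omega>: "\<omega> \<in> space M"
  shows "Y j k n \<omega> = y0 j k + n * drift n \<omega> j k + (\<Sum>m<n. noise j k m \<omega>)"
proof -
  have sampling: "(\<Sum>m<n. sampling_prob N K W Y j i m \<omega>)
      = n * (\<Sum>h<N. W $$ (j, h) * mean_proportion n \<omega> h i)" for i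
  proof -
    have scale: "real n * mean_proportion n \<omega> h i = (\<Sum>m<n. proportion K Y h i m \<omega>)" for h
      by (cases "n = 0") (auto simp: mean_proportion_def)
    have "(\<Sum>m<n. sampling_prob N K W Y j i m \<omega>)
        = (\<Sum>h<N. W $$ (j, h) * (\<Sum>m<n. proportion K Y h i m \<omega>))"
      unfolding sampling_prob_def by (subst sum.swap) (simp add: sum_distrib_left)
    also have "\<dots> = n * (\<Sum>h<N. W $$ (j, h) * mean_proportion n \<omega> h i)"
      unfolding scale[symmetric] by (simp add: sum_distrib_left mult_ac)
    finally show ?thesis .
  qed
  have "Y j k n \<omega> - Y j k 0 \<omega> = (\<Sum>m<n. Y j k (Suc m) \<omega> - Y j k m \<omega>)"
    using sum_lessThan_telescope[of "\<lambda>m. Y j k m \<omega>" n] by simp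
  also have "\<dots> = (\<Sum>m<n. \<Sum>i<K. H j k i * sampling_prob N K W Y j i m \<omega>) + (\<Sum>m<n. noise j k m \<omega>)"
    by (simp add: noise_def flip: sum.distrib)
  also have "(\<Sum>m<n. \<Sum>i<K. H j k i * sampling_prob N K W Y j i m \<omega>)
      = (\<Sum>i<K. H j k i * (\<Sum>m<n. sampling_prob N K W Y j i m \<omega>))"
    by (subst sum.swap) (simp add: sum_distrib_left)
  finally show ?thesis
    using Y_init[OF jk \<omega>] by (simp add: sampling drift_def sum_distrib_left mult_ac)
qed

lemma sum_mean_proportion:
  assumes "j < N" "\<omega> \<in> space M" "n > 0"
  shows "(\<Sum>k<K. mean_proportion n \<omega> j k) = 1"
proof -
  have "(\<Sum>k<K. mean_proportion n \<omega> j k) = (\<Sum>m<n. \<Sum>k<K. proportion K Y j k m \<omega>) / n"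
    unfolding mean_proportion_def sum_divide_distrib[symmetric] by (subst sum.swap) simp
  thus ?thesis using assms by (simp add: sum_proportion)
qed

lemma sum_drift:
  assumes "j < N" "\<omega> \<in> space M" "n > 0"
  shows "(\<Sum>k<K. drift n \<omega> j k) = 1"
proof -
  have "(\<Sum>k<K. drift n \<omega> j k)
      = (\<Sum>i<K. (\<Sum>k<K. H j k i) * (\<Sum>h<N. W $$ (j, h) * mean_proportion n \<omega> h i))"
    unfolding drift_def by (subst sum.swap) (simp add: sum_distrib_right)
  also have "\<dots> = (\<Sum>i<K. \<Sum>h<N. W $$ (j, h) * mean_proportion n \<omega> h i)"
    using sum_H[OF assms(1)] by simp
  also have "\<dots> = (\<Sum>h<N. W $$ (j, h) * (\<Sum>i<K. mean_proportion n \<omega> h i))"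
    by (subst sum.swap) (simp add: sum_distrib_left)
  also have "\<dots> = 1" using assms by (simp add: sum_mean_proportion W_row_sum)
  finally show ?thesis .
qed

lemma drift_bounds:
  assumes "j < N" "k < K" "\<omega> \<in> space M" "n > 0"
  shows "0 \<le> drift n \<omega> j k" "drift n \<omega> j k \<le> 1"
proof -
  have nn: "0 \<le> drift n \<omega> j k" if "k < K" for k
    unfolding drift_def mean_proportion_def using assms that
    by (intro sum_nonneg mult_nonneg_nonneg divide_nonneg_nonneg H_nonneg proportion_nonneg)
      (auto simp: W_bounds)
  show "0 \<le> drift n \<omega> j k" by (rule nn[OF assms(2)])
  show "drift n \<omega> j k \<le> 1"
    using member_le_sum[of k "{..<K}" "drift n \<omega> j"] sum_drift[OF assms(1,3,4)] nn assms(2) by auto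
qed

theorem AE_proportion_minus_drift:
  "AE \<omega> in M. \<forall>j<N. \<forall>k<K. (\<lambda>n. proportion K Y j k n \<omega> - drift n \<omega> j k) \<longlonglongrightarrow> 0"
proof -
  have "AE \<omega> in M. (\<lambda>n. (\<Sum>m<n. noise j k m \<omega>) / n) \<longlonglongrightarrow> 0" if "j < N" "k < K" for j k
    by (rule strong_law_orthogonal[OF noise_measurable[OF that] noise_sq_integrable[OF that]
          noise_orthogonal[OF that]])
  hence "AE \<omega> in M. \<forall>j\<in>{..<N}. \<forall>k\<in>{..<K}. (\<lambda>n. (\<Sum>m<n. noise j k m \<omega>) / n) \<longlonglongrightarrow> 0"
    by (intro AE_finite_allI) auto
  thus ?thesis
    using AE_space
  proof eventually_elim
    case (elim \<omega>)
    have scaled: "(\<lambda>n. Y j k n \<omega> / n - drift n \<omega> j k) \<longlonglongrightarrow> 0" if "j < N" "k < K" for j k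
    proof -
      have "(\<lambda>n. y0 j k / n + (\<Sum>m<n. noise j k m \<omega>) / n) \<longlonglongrightarrow> 0 + 0"
        using elim that by (intro tendsto_add lim_const_over_n) auto
      moreover have "y0 j k / n + (\<Sum>m<n. noise j k m \<omega>) / n = Y j k n \<omega> / n - drift n \<omega> j k"
        if "n > 0" for n
        using Y_eq_drift_noise[OF \<open>j < N\<close> \<open>k < K\<close> elim(2), of n] that by (simp add: field_simps)
      ultimately show ?thesis
        by (subst (asm) tendsto_cong[OF eventually_mono[OF eventually_gt_at_top[of 0]]]) auto
    qed
    show ?case
    proof (intro allI impI)
      fix j k assume jk: "j < N" "k < K"
      \<comment> \<open>The drift has urn sums 1, so adding up the colors determines the growth of
        the totals.\<close>
      have "(\<lambda>n. \<Sum>k<K. (Y j k n \<omega> / n - drift n \<omega> j k)) \<longlonglongrightarrow> (\<Sum>k<K. 0)"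
        using scaled jk by (intro tendsto_sum) auto
      hence tot: "(\<lambda>n. total K Y j n \<omega> / n - 1) \<longlonglongrightarrow> 0"
        using sum_drift[OF jk(1) elim(2)]
        by (subst (asm) tendsto_cong[OF eventually_mono[OF eventually_gt_at_top[of 0]]])
          (auto simp: total_def sum_subtractf sum_divide_distrib)
      hence tot1: "(\<lambda>n. total K Y j n \<omega> / n) \<longlonglongrightarrow> 1"
        by (simp add: LIM_zero_iff)
      have "(\<lambda>n. drift n \<omega> j k * (total K Y j n \<omega> / n - 1)) \<longlonglongrightarrow> 0"
      proof (rule Lim_null_comparison)
        show "(\<lambda>n. \<bar>total K Y j n \<omega> / n - 1\<bar>) \<longlonglongrightarrow> 0" using tot by (rule tendsto_rabs_zero)
        show "\<forall>\<^sub>F n in sequentially. norm (drift n \<omega> j k * (total K Y j n \<omega> / n - 1))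
            \<le> \<bar>total K Y j n \<omega> / n - 1\<bar>"
          by (rule eventually_mono[OF eventually_gt_at_top[of 0]])
            (use drift_bounds[OF jk elim(2)] in \<open>auto simp: abs_mult intro!: mult_left_le_one_le\<close>)
      qed
      \<comment> \<open>Writing \<open>T\<close> for the total, \<open>Z - drift\<close> is
        \<open>(Y / n - drift * (T / n)) / (T / n)\<close>; the numerator is split so that each part
        tends to 0.\<close>
      from tendsto_divide[OF tendsto_diff[OF scaled[OF jk] this] tot1]
      have "(\<lambda>n. (Y j k n \<omega> / n - drift n \<omega> j k - drift n \<omega> j k * (total K Y j n \<omega> / n - 1))
          / (total K Y j n \<omega> / n)) \<longlonglongrightarrow> 0" by simp
      moreover have "(Y j k n \<omega> / n - drift n \<omega> j k - drift n \<omega> j k * (total K Y j n \<omega> / n - 1))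
          / (total K Y j n \<omega> / n) = proportion K Y j k n \<omega> - drift n \<omega> j k" if "n > 0" for n
        using total_pos[OF jk(1) elim(2), of n] that
        by (simp add: proportion_def divide_simps) (simp add: algebra_simps)
      ultimately show "(\<lambda>n. proportion K Y j k n \<omega> - drift n \<omega> j k) \<longlonglongrightarrow> 0"
        by (subst (asm) tendsto_cong[OF eventually_mono[OF eventually_gt_at_top[of 0]]]) auto
    qed
  qed
qed

end

section \<open>Matrix form and conclusion\<close>

lemma sum_blocks:
  fixes f :: "nat \<Rightarrow> 'b :: comm_monoid_add"
  shows "(\<Sum>q<s * K. f q) = (\<Sum>h<s. \<Sum>i<K. f (h * K + i))"
proof -
  have "sum f {h * K..<h * K + K} = (\<Sum>i<K. f (h * K + i))" for h
    using sum.shift_bounds_nat_ivl[of f 0 "h * K" K] by (simp add: lessThan_atLeast0 add.commute)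
  thus ?thesis using sum.nat_group[of f K s] by simp
qed

text \<open>Removing the first block lowers the quotients by \<open>K\<close> by one and keeps the
  remainders.\<close>

lemma diag_block_mat_uniform:
  fixes As :: "'b :: comm_ring_1 mat list"
  assumes "\<And>A. A \<in> set As \<Longrightarrow> A \<in> carrier_mat K K"
  shows "diag_block_mat As \<in> carrier_mat (length As * K) (length As * K)"
    and "p < length As * K \<Longrightarrow> q < length As * K \<Longrightarrow> diag_block_mat As $$ (p, q)
      = (if p div K = q div K then As ! (p div K) $$ (p mod K, q mod K) else 0)"
proof -
  have "diag_block_mat As \<in> carrier_mat (length As * K) (length As * K) \<and>
    (\<forall>p<length As * K. \<forall>q<length As * K. diag_block_mat As $$ (p, q)
      = (if p div K = q div K then As ! (p div K) $$ (p mod K, q mod K) else 0))"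
    using assms
  proof (induction As)
    case (Cons A As)
    define B where "B = diag_block_mat As"
    have A: "A \<in> carrier_mat K K" using Cons.prems by simp
    have B: "B \<in> carrier_mat (length As * K) (length As * K)"
      and B_index: "\<And>p q. p < length As * K \<Longrightarrow> q < length As * K \<Longrightarrow> B $$ (p, q)
        = (if p div K = q div K then As ! (p div K) $$ (p mod K, q mod K) else 0)"
      using Cons unfolding B_def by auto
    have eq: "diag_block_mat (A # As) = four_block_mat A (0\<^sub>m K (length As * K)) (0\<^sub>m (length As * K) K) B"
      using A B by (auto simp: B_def Let_def)
    have "diag_block_mat (A # As) $$ (p, q)
        = (if p div K = q div K then (A # As) ! (p div K) $$ (p mod K, q mod K) else 0)"
      if p: "p < length (A # As) * K" and q: "q < length (A # As) * K" for p q
    proof -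
      have K: "K > 0" using p by (cases K) auto
      have big: "K \<le> x \<Longrightarrow> x div K = Suc ((x - K) div K) \<and> x mod K = (x - K) mod K" for x
        using K by (simp add: le_div_geq le_mod_geq)
      show ?thesis
        unfolding eq using A B p q big[of p] big[of q] B_index[of "p - K" "q - K"]
        by (cases "p < K"; cases "q < K") auto
    qed
    thus ?case unfolding eq using A B by auto
  qed auto
  thus "diag_block_mat As \<in> carrier_mat (length As * K) (length As * K)"
    and "p < length As * K \<Longrightarrow> q < length As * K \<Longrightarrow> diag_block_mat As $$ (p, q)
      = (if p div K = q div K then As ! (p div K) $$ (p mod K, q mod K) else 0)" by auto
qed

lemma joint_H_carrier:
  "joint_H M K r D l \<in> carrier_mat (class_size r l * K) (class_size r l * K)"
proof -
  define As where "As = map (generating_mat M K D) [r (l - 1)..<r l]"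
  have "\<And>A. A \<in> set As \<Longrightarrow> A \<in> carrier_mat K K" by (auto simp: As_def generating_mat_def)
  from diag_block_mat_uniform(1)[of As K, OF this]
  have "diag_block_mat As \<in> carrier_mat (length As * K) (length As * K)" .
  thus ?thesis by (simp add: joint_H_def class_size_def As_def)
qed

lemma joint_Q_carrier:
  "joint_Q M K r W D l \<in> carrier_mat (class_size r l * K) (class_size r l * K)"
  unfolding joint_Q_def by (rule mult_carrier_mat[OF joint_H_carrier]) (simp add: joint_W_def)

lemma mult_mat_vec_index:
  assumes "A \<in> carrier_mat n m" "v \<in> carrier_vec m" "p < n"
  shows "(A *\<^sub>v v) $ p = (\<Sum>q<m. A $$ (p, q) * v $ q)"
  using assms by (auto simp: scalar_prod_def lessThan_atLeast0)

text \<open>The identity blocks in \<open>joint_W\<close> keep only equal colors, the block diagonal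
  \<open>joint_H\<close> only equal urns, and the product takes the form of
  \<open>urn_mean_map.Q\<close>.\<close>

lemma joint_Q_mult_vec:
  assumes v: "v \<in> carrier_vec (class_size r l * K)" and j: "j < class_size r l" and k: "k < K"
  shows "(joint_Q M K r W D l *\<^sub>v v) $ (j * K + k) =
    (\<Sum>i<K. integral\<^sup>L M (D (r (l - 1) + j) 1 k i) *
      (\<Sum>h<class_size r l. W $$ (r (l - 1) + j, r (l - 1) + h) * v $ (h * K + i)))"
proof -
  define s a where "s = class_size r l" and "a = r (l - 1)"
  have index: "h * K + i < s * K" "(h * K + i) div K = h" "(h * K + i) mod K = i"
    if "h < s" "i < K" for h i
  proof -
    have "h * K + i < Suc h * K" using that by simp
    also have "\<dots> \<le> s * K" using that by (intro mult_right_mono) auto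
    finally show "h * K + i < s * K" .
  qed (use that in auto)
  define As where "As = map (generating_mat M K D) [a..<r l]"
  have As: "length As = s" "\<And>A. A \<in> set As \<Longrightarrow> A \<in> carrier_mat K K"
    by (auto simp: As_def s_def a_def class_size_def generating_mat_def)
  have joint_H_As: "joint_H M K r D l = diag_block_mat As"
    by (simp add: joint_H_def As_def a_def)
  have H: "joint_H M K r D l \<in> carrier_mat (s * K) (s * K)"
    unfolding s_def by (rule joint_H_carrier)
  have Wm: "joint_W K r W l \<in> carrier_mat (s * K) (s * K)" by (simp add: joint_W_def s_def)
  have v: "v \<in> carrier_vec (s * K)" using v by (simp add: s_def)
  have u: "joint_W K r W l *\<^sub>v v \<in> carrier_vec (s * K)" using Wm v by simp
  have W_index: "(joint_W K r W l *\<^sub>v v) $ (g * K + i) = (\<Sum>h<s. W $$ (a + g, a + h) * v $ (h * K + i))"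
    if g: "g < s" and i: "i < K" for g i
  proof -
    have "(joint_W K r W l *\<^sub>v v) $ (g * K + i)
        = (\<Sum>q<s * K. joint_W K r W l $$ (g * K + i, q) * v $ q)"
      by (rule mult_mat_vec_index[OF Wm v index(1)[OF g i]])
    also have "\<dots> = (\<Sum>h<s. \<Sum>i'<K. joint_W K r W l $$ (g * K + i, h * K + i') * v $ (h * K + i'))"
      by (rule sum_blocks)
    also have "\<dots> = (\<Sum>h<s. \<Sum>i'<K. if i = i' then W $$ (a + g, a + h) * v $ (h * K + i') else 0)"
      using index g i by (intro sum.cong refl) (simp add: joint_W_def s_def a_def)
    also have "\<dots> = (\<Sum>h<s. W $$ (a + g, a + h) * v $ (h * K + i))" using i by simp
    finally show ?thesis .
  qed
  have js: "j < s" using j by (simp add: s_def)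
  have "(joint_Q M K r W D l *\<^sub>v v) $ (j * K + k)
      = (joint_H M K r D l *\<^sub>v (joint_W K r W l *\<^sub>v v)) $ (j * K + k)"
    unfolding joint_Q_def by (subst assoc_mult_mat_vec[OF H Wm v]) simp
  also have "\<dots> = (\<Sum>q<s * K. joint_H M K r D l $$ (j * K + k, q) * (joint_W K r W l *\<^sub>v v) $ q)"
    by (rule mult_mat_vec_index[OF H u index(1)[OF js k]])
  also have "\<dots> = (\<Sum>h<s. \<Sum>i<K. joint_H M K r D l $$ (j * K + k, h * K + i)
      * (joint_W K r W l *\<^sub>v v) $ (h * K + i))"
    by (rule sum_blocks)
  also have "\<dots> = (\<Sum>h<s. if j = h then \<Sum>i<K. integral\<^sup>L M (D (a + h) 1 k i)
      * (joint_W K r W l *\<^sub>v v) $ (h * K + i) else 0)"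
  proof (intro sum.cong refl)
    fix h assume "h \<in> {..<s}"
    hence h: "h < s" by simp
    have "joint_H M K r D l $$ (j * K + k, h * K + i)
        = (if j = h then integral\<^sup>L M (D (a + h) 1 k i) else 0)" if i: "i < K" for i
    proof -
      have "As ! j $$ (k, i) = integral\<^sup>L M (D (a + j) 1 k i)"
        using js As(1) k i by (simp add: As_def generating_mat_def)
      thus ?thesis
        using diag_block_mat_uniform(2)[of As K "j * K + k" "h * K + i"] As(2) index js k h i As(1)
        by (auto simp: joint_H_As)
    qed
    thus "(\<Sum>i<K. joint_H M K r D l $$ (j * K + k, h * K + i) * (joint_W K r W l *\<^sub>v v) $ (h * K + i))
        = (if j = h then \<Sum>i<K. integral\<^sup>L M (D (a + h) 1 k i)
            * (joint_W K r W l *\<^sub>v v) $ (h * K + i) else 0)" by simp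
  qed
  also have "\<dots> = (\<Sum>i<K. integral\<^sup>L M (D (a + j) 1 k i) * (joint_W K r W l *\<^sub>v v) $ (j * K + i))"
    using js by simp
  finally show ?thesis using W_index[OF js] unfolding s_def a_def by simp
qed

lemma class_decomposition_bounds:
  assumes "class_decomposition N W nL nF r" "l \<in> {1..nL + nF}"
  shows "r (l - 1) < r l" "r l \<le> N"
proof -
  have step: "r i < r (Suc i)" if "i < nL + nF" for i
    using assms(1) that by (auto simp: class_decomposition_def)
  show "r (l - 1) < r l" using step[of "l - 1"] assms(2) by auto
  have "l \<le> nL + nF" using assms(2) by simp
  hence "r l \<le> r (nL + nF)"
  proof (induction rule: inc_induct)
    case (step i)
    thus ?case using \<open>\<And>i. i < nL + nF \<Longrightarrow> r i < r (Suc i)\<close>[of i] by linarith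
  qed simp
  thus "r l \<le> N" using assms(1) by (simp add: class_decomposition_def)
qed

text \<open>A successor of a recurrent state leads back to it, hence communicates with it and lies
  in its class. This allows sums over all urns to be cut down to a leading class.\<close>

lemma leading_class_closed:
  assumes W: "W \<in> carrier_mat N N" and nonneg: "\<And>j h. j < N \<Longrightarrow> h < N \<Longrightarrow> W $$ (j, h) \<ge> 0"
    and rows: "\<And>j. j < N \<Longrightarrow> (\<Sum>h<N. W $$ (j, h)) = 1"
    and classes: "class_decomposition N W nL nF r" and l: "l \<in> {1..nL}"
    and j: "j \<in> urn_class r l" and h: "h < N" "h \<notin> urn_class r l"
  shows "W $$ (j, h) = 0"
proof (rule ccontr)
  have "l \<in> {1..nL + nF}" using l by auto
  note bounds = class_decomposition_bounds[OF classes this]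
  have jN: "j < N" using j bounds by (auto simp: urn_class_def)
  assume "W $$ (j, h) \<noteq> 0"
  hence pos: "W $$ (j, h) > 0" using nonneg[OF jN h(1)] by simp
  have "recurrent_state W j" using classes l j by (auto simp: class_decomposition_def)
  hence "leads_to W h j" by (intro recurrent_successor_leads_back[OF W nonneg rows jN h(1) _ pos])
  moreover have "leads_to W h h" using W h unfolding leads_to_def by (intro exI[of _ 0]) auto
  hence "leads_to W j h" by (intro leads_to_step[OF W nonneg jN h(1) h(1) pos])
  ultimately have "communicate W j h" by (simp add: communicate_def)
  moreover have "urn_class r l = {h. h < N \<and> communicate W j h}"
    using classes l j by (auto simp: class_decomposition_def)
  ultimately show False using h by blast
qed

lemma square_le_powr:
  fixes x \<delta> :: real
  assumes "x \<ge> 0" "\<delta> > 0"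
  shows "x\<^sup>2 \<le> 1 + x powr (2 + \<delta>)"
proof (cases "x \<le> 1")
  case True
  hence "x\<^sup>2 \<le> 1" using assms by (simp add: power_le_one)
  thus ?thesis by (simp add: add_increasing2)
next
  case False
  hence "x\<^sup>2 = x powr 2" by simp
  also have "\<dots> \<le> x powr (2 + \<delta>)" using False assms by (intro powr_mono) auto
  finally show ?thesis by simp
qed

theorem theorem4p1:
  fixes M :: "'a measure"
    and N K nL nF l :: nat
    and W :: "real mat"
    and y0 :: "nat \<Rightarrow> nat \<Rightarrow> real"
    and X Y :: "nat \<Rightarrow> nat \<Rightarrow> nat \<Rightarrow> 'a \<Rightarrow> real"
    and D :: "nat \<Rightarrow> nat \<Rightarrow> nat \<Rightarrow> nat \<Rightarrow> 'a \<Rightarrow> real"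
    and r :: "nat \<Rightarrow> nat"
  assumes urns: "interacting_urns M N K W y0 X Y D"
    and classes: "class_decomposition N W nL nF r"
    and A1: "\<exists>\<delta>>0. \<exists>C>0. \<forall>j<N. \<forall>n\<ge>1. \<forall>k<K. \<forall>i<K.
      integrable M (\<lambda>\<omega>. D j n k i \<omega> powr (2 + \<delta>)) \<and>
      integral\<^sup>L M (\<lambda>\<omega>. D j n k i \<omega> powr (2 + \<delta>)) < C"
    and A2: "\<forall>j<N. \<forall>i<K. (\<Sum>k<K. generating_mat M K D j $$ (k, i)) = 1"
    and A3: "\<forall>j<N. irreducible_mat (generating_mat M K D j)"
    and leading: "l \<in> {1..nL}"
    and simple: "simple_eigenvalue (joint_Q M K r W D l) 1"
  shows "\<exists>V. eigenvector (joint_Q M K r W D l) V 1 \<and>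
             urnwise_normalized K (class_size r l) V \<and>
             (\<forall>V'. eigenvector (joint_Q M K r W D l) V' 1 \<and>
                   urnwise_normalized K (class_size r l) V' \<longrightarrow> V' = V) \<and>
             (AE \<omega> in M. \<forall>a<class_size r l * K.
                (\<lambda>n. joint_proportions K r Y l n \<omega> $ a) \<longlonglongrightarrow> V $ a)"
proof -
  interpret interacting_urns M N K W y0 X Y D by (rule urns)
  obtain \<delta> C where \<delta>: "\<delta> > 0" and moment: "\<And>j n k i. j < N \<Longrightarrow> n \<ge> 1 \<Longrightarrow> k < K \<Longrightarrow> i < K \<Longrightarrow>
      integrable M (\<lambda>\<omega>. D j n k i \<omega> powr (2 + \<delta>)) \<and>
      integral\<^sup>L M (\<lambda>\<omega>. D j n k i \<omega> powr (2 + \<delta>)) < C"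
    using A1 by blast
  have sq: "integrable M (\<lambda>\<omega>. (D j n k i \<omega>)\<^sup>2) \<and> (\<integral>\<omega>. (D j n k i \<omega>)\<^sup>2 \<partial>M) \<le> 1 + C"
    if idx: "j < N" "n \<ge> 1" "k < K" "i < K" for j n k i
  proof -
    have bound: "integrable M (\<lambda>\<omega>. 1 + D j n k i \<omega> powr (2 + \<delta>))"
      using moment[OF idx] by simp
    have le: "(D j n k i \<omega>)\<^sup>2 \<le> 1 + D j n k i \<omega> powr (2 + \<delta>)" if "\<omega> \<in> space M" for \<omega>
      using square_le_powr[OF D_nonneg[OF idx that] \<delta>] .
    have int: "integrable M (\<lambda>\<omega>. (D j n k i \<omega>)\<^sup>2)"
      by (rule Bochner_Integration.integrable_bound[OF bound])
        (use D_measurable[OF idx] le in \<open>auto intro!: AE_I2 order.trans[OF le abs_ge_self]\<close>)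
    have "(\<integral>\<omega>. (D j n k i \<omega>)\<^sup>2 \<partial>M) \<le> (\<integral>\<omega>. 1 + D j n k i \<omega> powr (2 + \<delta>) \<partial>M)"
      by (rule integral_mono[OF int bound le])
    also have "\<dots> \<le> 1 + C" using moment[OF idx] by (simp add: prob_space)
    finally show ?thesis using int by blast
  qed
  interpret balanced_urns M N K W y0 X Y D "1 + C"
    by unfold_locales (use sq A2 in \<open>auto simp: generating_mat_def\<close>)
  have "l \<in> {1..nL + nF}" using leading by auto
  note bounds = class_decomposition_bounds[OF classes this]
  define a s S where "a = r (l - 1)" and "s = class_size r l" and "S = urn_class r l"
  have S: "S = (\<lambda>h. a + h) ` {..<s}" and S_N: "S \<subseteq> {..<N}" and s_pos: "s > 0"
    using bounds by (auto simp: S_def urn_class_def s_def class_size_def a_def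
        image_add_atLeastLessThan lessThan_atLeast0)
  have nonneg: "\<And>j h. j < N \<Longrightarrow> h < N \<Longrightarrow> W $$ (j, h) \<ge> 0" using W_bounds by blast
  have closed: "W $$ (j, h) = 0" if "j \<in> S" "h \<in> {..<N} - S" for j h
    using leading_class_closed[OF W_carrier nonneg W_row_sum classes leading] that
    by (auto simp: S_def)
  have sum_S: "(\<Sum>h<N. W $$ (j, h) * f h) = (\<Sum>h\<in>S. W $$ (j, h) * f h)" if "j \<in> S" for j f
    using closed[OF that] S_N by (intro sum.mono_neutral_right) auto
  interpret mean: urn_mean_map S K "\<lambda>j h. W $$ (j, h)" H
  proof
    show "finite S" "S \<noteq> {}" "K > 0" using S s_pos K_pos by auto
    show "(\<Sum>h\<in>S. W $$ (j, h)) = 1" if "j \<in> S" for j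
      using sum_S[OF that, of "\<lambda>_. 1"] W_row_sum[of j] that S_N by auto
  qed (use S_N nonneg H_nonneg sum_H in \<open>auto simp: subset_iff\<close>)
  define A where "A = joint_Q M K r W D l"
  have A: "A \<in> carrier_mat (s * K) (s * K)" unfolding A_def s_def by (rule joint_Q_carrier)
  have index: "h * K + i < s * K" "(h * K + i) div K = h" "(h * K + i) mod K = i"
    if "h < s" "i < K" for h i
  proof -
    have "h * K + i < Suc h * K" using that by simp
    also have "\<dots> \<le> s * K" using that by (intro mult_right_mono) auto
    finally show "h * K + i < s * K" .
  qed (use that in auto)
  have unindex: "q div K < s" "q mod K < K" "q div K * K + q mod K = q" if "q < s * K" for q
    using that K_pos by (auto simp: less_mult_imp_div_less)
  \<comment> \<open>The urns of the class are numbered from \<open>a\<close>, the blocks of a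
    stacked vector from 0.\<close>
  define unstack where "unstack v j k = v $ ((j - a) * K + k)" for v :: "real vec" and j k
  define stack where "stack x = Matrix.vec (s * K) (\<lambda>q. x (a + q div K) (q mod K))"
    for x :: "nat \<Rightarrow> nat \<Rightarrow> real"
  have stack: "stack x \<in> carrier_vec (s * K)" for x by (simp add: stack_def)
  have stack_index: "stack x $ (h * K + i) = x (a + h) i" if "h < s" "i < K" for x h i
    using index[OF that] by (simp add: stack_def)
  have unstack_stack: "unstack (stack x) j k = x j k" if "j \<in> S" "k < K" for x j k
    using that by (auto simp: unstack_def S stack_index)
  have A_mult: "(A *\<^sub>v v) $ (j * K + k) = mean.Q (unstack v) (a + j) k"
    if v: "v \<in> carrier_vec (s * K)" and jk: "j < s" "k < K" for v j k
  proof -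
    have "(\<Sum>h\<in>S. W $$ (a + j, h) * unstack v h i)
        = (\<Sum>h<s. W $$ (a + j, a + h) * v $ (h * K + i))" for i
      unfolding S by (subst sum.reindex) (auto simp: unstack_def)
    thus ?thesis
      unfolding A_def mean.Q_def using joint_Q_mult_vec[of v r l K j k M W D] v jk
      by (simp add: H_def s_def a_def)
  qed
  have fixed_iff: "A *\<^sub>v v = 1 \<cdot>\<^sub>v v \<longleftrightarrow> (\<forall>j\<in>S. \<forall>k<K. mean.Q (unstack v) j k = unstack v j k)"
    if v: "v \<in> carrier_vec (s * K)" for v
  proof
    assume eq: "A *\<^sub>v v = 1 \<cdot>\<^sub>v v"
    have "mean.Q (unstack v) (a + j) k = unstack v (a + j) k" if "j < s" "k < K" for j k
      using A_mult[OF v that] eq index(1)[OF that] v by (simp add: unstack_def)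
    thus "\<forall>j\<in>S. \<forall>k<K. mean.Q (unstack v) j k = unstack v j k" unfolding S by auto
  next
    assume fixed: "\<forall>j\<in>S. \<forall>k<K. mean.Q (unstack v) j k = unstack v j k"
    show "A *\<^sub>v v = 1 \<cdot>\<^sub>v v"
    proof (rule eq_vecI)
      fix q assume "q < dim_vec (1 \<cdot>\<^sub>v v)"
      hence q: "q < s * K" using v by simp
      have "a + q div K \<in> S" unfolding S using unindex(1)[OF q] by auto
      hence "mean.Q (unstack v) (a + q div K) (q mod K) = v $ q"
        using fixed unindex[OF q] by (auto simp: unstack_def)
      thus "(A *\<^sub>v v) $ q = (1 \<cdot>\<^sub>v v) $ q"
        using A_mult[OF v unindex(1,2)[OF q]] unindex(3)[OF q] q v by simp
    qed (use A v in simp)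
  qed
  have normalized_iff: "urnwise_normalized K s v \<longleftrightarrow> (\<forall>j\<in>S. (\<Sum>k<K. unstack v j k) = 1)" for v
    unfolding urnwise_normalized_def S by (auto simp: unstack_def)
  obtain x where x: "\<And>j k. j \<in> S \<Longrightarrow> k < K \<Longrightarrow> mean.Q x j k = x j k"
    and x_sum: "\<And>j. j \<in> S \<Longrightarrow> (\<Sum>k<K. x j k) = 1"
    using mean.fixed_point_exists by blast
  have stack_fixed: "A *\<^sub>v stack z = 1 \<cdot>\<^sub>v stack z"
    if "\<And>j k. j \<in> S \<Longrightarrow> k < K \<Longrightarrow> mean.Q z j k = z j k" for z
    using that mean.Q_cong[of "unstack (stack z)" z] unstack_stack
    by (subst fixed_iff[OF stack]) auto
  have regular: mean.regular
    unfolding mean.regular_def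
  proof (intro allI impI ballI)
    fix z j k
    assume z_sum: "\<forall>j\<in>S. (\<Sum>k<K. z j k) = 0" and z: "\<forall>j\<in>S. \<forall>k<K. mean.Q z j k = z j k"
      and jk: "j \<in> S" "k < K"
    \<comment> \<open>Comparing \<open>z\<close> with \<open>x\<close> inside a single urn is
      enough: summing the vanishing minors over the color \<open>i\<close> gives
      \<open>1 * z j k\<close> on one side and \<open>0 * x j k\<close> on the other.\<close>
    obtain h where h: "j = a + h" "h < s" using jk(1) unfolding S by auto
    have "x j i * z j k = z j i * x j k" if "i < K" for i
      using simple_eigenvalue_eigenvectors_parallel[OF A simple[folded A_def] stack
          stack_fixed[OF x] stack stack_fixed[of z] index(1)[of h i] index(1)[of h k]]
        z h jk that by (simp add: stack_index)
    hence "(\<Sum>i<K. x j i) * z j k = (\<Sum>i<K. z j i) * x j k"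
      unfolding sum_distrib_right by (intro sum.cong) auto
    thus "z j k = 0" using x_sum z_sum jk(1) by simp
  qed
  have "AE \<omega> in M. \<forall>q<s * K. (\<lambda>n. joint_proportions K r Y l n \<omega> $ q) \<longlonglongrightarrow> stack x $ q"
    using AE_proportion_minus_drift AE_space
  proof eventually_elim
    case (elim \<omega>)
    \<comment> \<open>The class being closed, the drift of its urns depends on the averages in the
      class alone.\<close>
    have drift: "mean.Q (mean_proportion n \<omega>) j k = drift n \<omega> j k" if "j \<in> S" for n j k
      unfolding mean.Q_def drift_def using sum_S[OF that] by simp
    define e where "e n j k = proportion K Y j k n \<omega> - mean.Q (mean_proportion n \<omega>) j k" for n j k
    have e: "(\<lambda>n. e n j k) \<longlonglongrightarrow> 0" if "j \<in> S" "k < K" for j k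
      using elim(1) that S_N drift by (auto simp: e_def)
    have lim: "(\<lambda>n. mean_proportion n \<omega> j k) \<longlonglongrightarrow> x j k" if "j \<in> S" "k < K" for j k
    proof (rule mean.averaging_recursion_converges[OF regular _ _ e x x_sum that])
      show "mean_proportion (Suc n) \<omega> j k = mean_proportion n \<omega> j k
          + (mean.Q (mean_proportion n \<omega>) j k - mean_proportion n \<omega> j k + e n j k) / (real n + 1)"
        if "n > 0" for n j k
      proof -
        \<comment> \<open>The update of an average by one new value, with \<open>c\<close> the sum
          of the first \<open>n\<close> values.\<close>
        have "(c + z) / (real n + 1) = c / n + (z - c / n) / (real n + 1)" for c z
          using that by (simp add: divide_simps) (simp add: algebra_simps)
        from this[of "\<Sum>m<n. proportion K Y j k m \<omega>" "proportion K Y j k n \<omega>"] show ?thesis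
          by (simp add: mean_proportion_def e_def add.commute[of 1])
      qed
      show "(\<Sum>k<K. mean_proportion n \<omega> j k) = 1" if "n > 0" "j \<in> S" for n j
        using sum_mean_proportion elim(2) that S_N by auto
    qed
    \<comment> \<open>The averages converge; the proportions follow because they differ from
      \<open>Q\<close> of the averages by \<open>e n\<close>, and \<open>x\<close> is fixed by the
      continuous \<open>Q\<close>.\<close>
    have "(\<lambda>n. proportion K Y j k n \<omega>) \<longlonglongrightarrow> x j k" if "j \<in> S" "k < K" for j k
    proof -
      have "(\<lambda>n. mean.Q (mean_proportion n \<omega>) j k) \<longlonglongrightarrow> mean.Q x j k"
        by (rule mean.Q_tendsto[OF lim])
      from tendsto_add[OF e[OF that] this] show ?thesis using x[OF that] by (simp add: e_def)
    qed
    moreover have "a + q div K \<in> S" "q mod K < K" if "q < s * K" for q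
      using unindex[OF that] unfolding S by auto
    ultimately show ?case
      unfolding joint_proportions_def stack_def s_def[symmetric] a_def[symmetric] by simp
  qed
  moreover have x_normalized: "urnwise_normalized K s (stack x)"
    unfolding normalized_iff using x_sum unstack_stack by simp
  moreover have nonzero: "v \<noteq> 0\<^sub>v (s * K)" if "urnwise_normalized K s v" for v
  proof
    assume "v = 0\<^sub>v (s * K)"
    hence "(\<Sum>k<K. v $ (0 * K + k)) = 0" using index(1)[OF s_pos] by simp
    thus False using that s_pos unfolding urnwise_normalized_def by fastforce
  qed
  have x_eigen: "eigenvector A (stack x) 1"
    unfolding eigenvector_def using A stack[of x] stack_fixed[OF x] nonzero[OF x_normalized] by simp
  moreover have "v = stack x" if eig: "eigenvector A v 1" and norm: "urnwise_normalized K s v" for v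
  proof -
    have v: "v \<in> carrier_vec (s * K)" "A *\<^sub>v v = 1 \<cdot>\<^sub>v v"
      using eig A by (auto simp: eigenvector_def)
    \<comment> \<open>The difference of two normalized eigenvectors is fixed and has vanishing urn
      sums, so \<open>regular\<close> applies to it.\<close>
    define z where "z j k = 1 * unstack v j k + (-1) * x j k" for j k
    have "mean.Q z j k = 1 * mean.Q (unstack v) j k + (-1) * mean.Q x j k" for j k
      unfolding z_def[abs_def] mean.Q_comb ..
    hence "mean.Q z j k = z j k" if "j \<in> S" "k < K" for j k
      using fixed_iff[OF v(1)] v(2) x that by (simp add: z_def)
    moreover have "(\<Sum>k<K. z j k) = 0" if "j \<in> S" for j
      using norm that x_sum by (simp add: normalized_iff z_def sum_subtractf)
    ultimately have z0: "z j k = 0" if "j \<in> S" "k < K" for j k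
      using regular that unfolding mean.regular_def by blast
    show ?thesis
    proof (rule eq_vecI)
      fix q assume "q < dim_vec (stack x)"
      hence q: "q < s * K" by (simp add: stack_def)
      have "a + q div K \<in> S" unfolding S using unindex(1)[OF q] by auto
      from z0[OF this unindex(2)[OF q]] show "v $ q = stack x $ q"
        using unindex(3)[OF q] q by (simp add: z_def unstack_def stack_def)
    qed (use v in \<open>simp add: stack_def\<close>)
  qed
  ultimately show ?thesis unfolding A_def s_def by blast
qed

end
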